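(* Let $b>1$ be an integer and let $w$ be a non-empty word of length $p=|w|$ over the alphabet $\{0,\dots,b-1\}$. There exist real numbers (called eigenvalues) $\lambda_j(b,w)$, $j\ge 1$, satisfying $$1=\lambda_1(b,w)>\lambda_2(b,w)>\dots>\lambda_j(b,w)>\dots>0,\qquad \lambda_j(b,w)\to 0 \text{ as } j\to\infty,$$ and coefficients $\alpha_j(b,w)$, $j\ge2$, such that for every integer $k\ge1$ $$I(b,w,k)=b^p\log(b)+\sum_{j=2}^\infty \alpha_j(b,w)\,\lambda_j(b,w)^k,$$ with an absolutely convergent series. The numbers $\lambda_j(b,w)$ are rational numbers determined by $b$, the length of $w$ and the lengths of the borders of $w$. If $w$ has no borders (in particular if $p=1$), then $\lambda_j(b,w)=\bigl(b^{pj}-b^{pj-j+1}+1\bigr)^{-1}$ for every $j\geq1$.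
   Context: For an integer $n>0$, $k_w(n)$ denotes the number of occurrences (overlapping occurrences are all counted) of $w$ as a block of consecutive digits in the base-$b$ representation of $n$ without leading zeros. For $k\ge0$, $I(b,w,k)=\sum_{n>0,\;k_w(n)=k}\frac1n$ (a convergent series). A border of $w$ is a non-empty word, different from $w$, which is both a prefix and a suffix of $w$. $\log$ is the natural logarithm. *)

theory Defs
  imports "HOL-Analysis.Analysis" "HOL-Library.Sublist"
begin

(* Words are lists of digits, most significant digit first.  The value for b < 2 is a dummy. *)
function base_repr :: "nat \<Rightarrow> nat \<Rightarrow> nat list" where
  "base_repr b n = (if b < 2 \<or> n = 0 then [] else base_repr b (n div b) @ [n mod b])"
  by auto
termination
  by (relation "Wellfounded.measure snd") auto

declare base_repr.simps [simp del]

(* An occurrence of w in u is a factorisation u = x @ w @ y, so overlapping occurrences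
   are all counted. *)
definition occurrences :: "'a list \<Rightarrow> 'a list \<Rightarrow> nat" where
  "occurrences w u = card {(x, y). u = x @ w @ y}"

definition block_count :: "nat \<Rightarrow> nat list \<Rightarrow> nat \<Rightarrow> nat" where
  "block_count b w n = occurrences w (base_repr b n)"

definition I_sum :: "nat \<Rightarrow> nat list \<Rightarrow> nat \<Rightarrow> real" where
  "I_sum b w k = (\<Sum>\<^sub>\<infinity>n | n > 0 \<and> block_count b w n = k. 1 / real n)"

definition is_border :: "'a list \<Rightarrow> 'a list \<Rightarrow> bool" where
  "is_border v w \<longleftrightarrow> v \<noteq> [] \<and> v \<noteq> w \<and> prefix v w \<and> suffix v w"

definition border_lengths :: "'a list \<Rightarrow> nat set" where
  "border_lengths w = {length v | v. is_border v w}"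

definition nonempty_word :: "nat \<Rightarrow> nat list \<Rightarrow> bool" where
  "nonempty_word b w \<longleftrightarrow> w \<noteq> [] \<and> set w \<subseteq> {0..<b}"

end

theory Submission
  imports Defs
begin

text \<open>
  For a word \<open>v\<close> let \<open>T\<^sub>v f x = f ((n(v) + x) / b^|v|) / b^|v|\<close>, and let \<open>r k f\<close> be the sum of
  \<open>f (0.u) / b^|u|\<close> over all words \<open>u\<close> such that \<open>w @ u\<close> contains \<open>w\<close> exactly \<open>k\<close> times. Removing
  first letters and overlaps of \<open>w\<close> with itself gives \<open>r (k + 1) (P f) = r k (B f)\<close> for \<open>k \<ge> 1\<close>, where
  \<open>P = B + 1 - A\<close>, \<open>A = \<Sum>d<b. T\<^bsub>d\<^esub>\<close>, \<open>B = T\<^bsub>w\<^esub> + \<Sum>q. T\<^bsub>v q\<^esub> (1 - A)\<close>; here \<open>q\<close> runs over the periods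
  \<open>|w| - |border|\<close> and \<open>v q\<close> is the suffix of \<open>w\<close> of length \<open>q\<close>. On polynomials both operators are
  triangular, and the eigenvalues are the ratios of the diagonal entries of \<open>B\<close> and \<open>P\<close>. The moments
  of \<open>r\<close> are therefore finite combinations of powers of eigenvalues. Taking the moments about the
  fixed point of \<open>T\<^sub>v\<close>, for \<open>v\<close> the suffix of \<open>w\<close> belonging to the least period, the coefficients of
  the \<open>m\<close>-th moment grow at most like \<open>rad^m\<close> with \<open>rad < b / (b - 1)\<close>, so the Taylor series of
  \<open>1 / (n + x)\<close> about the same point may be inserted once
  \<open>n\<close> plus that point is at least \<open>b / (b - 1)\<close>. Smaller \<open>n\<close> are avoided by splitting off one more
  digit. The eigenvalue 1 belongs to the \<open>A\<close>-invariant
  functional \<open>b^|w| \<integral>\<close>, which yields \<open>b^|w| log b\<close>.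
\<close>

section \<open>Words, occurrences and periods\<close>

lemma finite_occurrences: "finite {(x, y). u = x @ w @ y}"
proof -
  have "{(x, y). u = x @ w @ y} \<subseteq> (\<lambda>i. (take i u, drop (i + length w) u)) ` {..length u}"
  proof
    fix p assume "p \<in> {(x, y). u = x @ w @ y}"
    then obtain x y where "p = (x, y)" "u = x @ w @ y" by auto
    then show "p \<in> (\<lambda>i. (take i u, drop (i + length w) u)) ` {..length u}"
      by (intro image_eqI[of _ _ "length x"]) auto
  qed
  then show ?thesis
    by (rule finite_subset) simp
qed

lemma occurrences_Nil: "w \<noteq> [] \<Longrightarrow> occurrences w [] = 0"
  by (auto simp: occurrences_def)

lemma occurrences_Cons:
  fixes w :: "'a list"
  shows "occurrences w (d # u) = occurrences w u + of_bool (prefix w (d # u))"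
proof -
  let ?S = "{(x, y). u = x @ w @ y}" and ?f = "\<lambda>(x, y). (d # x, y)"
  let ?E = "{(x :: 'a list, y). x = [] \<and> d # u = w @ y}"
  have split: "{(x, y). d # u = x @ w @ y} = ?f ` ?S \<union> ?E"
    by (auto simp: image_iff Cons_eq_append_conv)
  have "card (?f ` ?S) = card ?S"
    by (intro card_image) (auto simp: inj_on_def)
  moreover have "card ?E = of_bool (prefix w (d # u))"
  proof (cases "prefix w (d # u)")
    case True
    then obtain y where "d # u = w @ y" by (auto simp: prefix_def)
    then have "?E = {([], y)}" by auto
    then show ?thesis using True by simp
  next
    case False
    then have "?E = {}" by (auto simp: prefix_def)
    then show ?thesis using False by simp
  qed
  moreover have "finite ?E" "finite (?f ` ?S)"
    using finite_occurrences[of "d # u" w] unfolding split by auto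
  moreover have "?f ` ?S \<inter> ?E = {}" by auto
  ultimately show ?thesis
    unfolding occurrences_def split by (simp add: card_Un_disjoint)
qed


text \<open>Blocks inside either factor survive concatenation; blocks across the junction are only
  gained. This superadditivity is the source of all summability below.\<close>

lemma occurrences_append_ge:
  assumes "w \<noteq> []"
  shows "occurrences w u + occurrences w v \<le> occurrences w (u @ v)"
proof (induction u)
  case (Cons d u)
  have "prefix w (d # u) \<Longrightarrow> prefix w (d # u @ v)"
    by (metis append_Cons prefix_def append_assoc)
  with Cons show ?case by (auto simp: occurrences_Cons)
qed (simp add: occurrences_Nil assms)

lemma occurrences_self: "w \<noteq> [] \<Longrightarrow> occurrences w (w @ u) = Suc (occurrences w (tl w @ u))"
  by (cases w) (auto simp: occurrences_Cons)

text \<open>The shifts at which \<open>w\<close> overlaps a copy of itself; they correspond to the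
  borders through \<open>q = length w - l\<close>. The shift by the whole length is excluded, as the
  empty border is.\<close>

definition periods :: "'a list \<Rightarrow> nat set" where
  "periods w = {q. 0 < q \<and> q < length w \<and> drop q w = take (length w - q) w}"

lemma finite_periods [simp]: "finite (periods w)"
  by (rule finite_subset[of _ "{..length w}"]) (auto simp: periods_def)

lemma border_lengths_eq: "border_lengths w = (\<lambda>q. length w - q) ` periods w"
proof (intro equalityI subsetI)
  fix l assume "l \<in> border_lengths w"
  then obtain v where v: "l = length v" "v \<noteq> []" "v \<noteq> w" "prefix v w" "suffix v w"
    by (auto simp: border_lengths_def is_border_def)
  from v(5) obtain x where x: "w = x @ v" by (auto simp: suffix_def)
  from v(4) obtain y where y: "w = v @ y" by (auto simp: prefix_def)
  have "drop (length x) w = v" using x by simp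
  moreover have "take (length w - length x) w = v"
  proof -
    have "length w - length x = length v" using x by simp
    then show ?thesis using y by simp
  qed
  moreover have "0 < length x" using x v by auto
  moreover have "length x < length w" using x v by auto
  ultimately have "length x \<in> periods w" by (auto simp: periods_def)
  moreover have "l = length w - length x" using x v by simp
  ultimately show "l \<in> (\<lambda>q. length w - q) ` periods w" by blast
next
  fix l assume "l \<in> (\<lambda>q. length w - q) ` periods w"
  then obtain q where q: "q \<in> periods w" "l = length w - q" by auto
  have "is_border (drop q w) w" unfolding is_border_def
  proof (intro conjI)
    show "drop q w \<noteq> []" using q by (auto simp: periods_def)
    show "drop q w \<noteq> w" using q by (metis (mono_tags) periods_def mem_Collect_eq length_drop diff_less less_irrefl order.strict_trans)
    show "prefix (drop q w) w" using q by (auto simp: periods_def take_is_prefix)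
    show "suffix (drop q w) w" by (rule suffix_drop)
  qed
  then show "l \<in> border_lengths w" using q by (force simp: border_lengths_def)
qed

text \<open>The eigenvalues arise as sums over periods; this makes them functions of the border
  lengths.\<close>

lemma sum_border_lengths:
  "(\<Sum>l\<in>border_lengths w. f (length w - l)) = (\<Sum>q\<in>periods w. f q)"
  unfolding border_lengths_eq
  by (subst sum.reindex) (auto simp: inj_on_def periods_def intro!: sum.cong)

text \<open>A copy of \<open>w\<close> starting inside the leading \<open>w\<close> must agree with
  it on the overlap, which makes \<open>q\<close> a period, and must read its remaining
  \<open>q\<close> letters from \<open>u\<close>.\<close>

lemma prefix_drop_append_iff:
  assumes "0 < q" "q < length w"
  shows "prefix w (drop q (w @ u)) \<longleftrightarrow> q \<in> periods w \<and> prefix (drop (length w - q) w) u"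
proof -
  have "prefix w (drop q (w @ u)) \<longleftrightarrow> prefix (take (length w - q) w @ drop (length w - q) w) (drop q w @ u)"
    using assms by simp
  also have "\<dots> \<longleftrightarrow> take (length w - q) w = drop q w \<and> prefix (drop (length w - q) w) u"
    using assms by (auto simp: prefix_def append_eq_append_conv simp del: append_take_drop_id)
  finally show ?thesis using assms by (auto simp: periods_def)
qed

definition occ_ind :: "'a list \<Rightarrow> nat \<Rightarrow> 'a list \<Rightarrow> real" where
  "occ_ind w k u = of_bool (occurrences w u = k)"

text \<open>Push-forward of the weight \<open>\<phi>\<close> under \<open>u \<mapsto> v @ u\<close>,
  supported on the words that start with \<open>v\<close>.\<close>

definition after :: "'a list \<Rightarrow> ('a list \<Rightarrow> real) \<Rightarrow> 'a list \<Rightarrow> real" where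
  "after v \<phi> u = (if prefix v u then \<phi> (drop (length v) u) else 0)"

text \<open>Removing the letters of the leading \<open>w\<close> from \<open>w @ u\<close> one at a time, the count of \<open>w\<close>
  drops exactly at the periods whose shifted copy of \<open>w\<close> continues into \<open>u\<close>.\<close>
lemma occ_ind_periods:
  assumes "w \<noteq> []"
  shows "occ_ind w k u = occ_ind w (Suc k) (w @ u) + (\<Sum>q\<in>periods w.
     after (drop (length w - q) w) (\<lambda>z. occ_ind w (Suc k) (w @ z) - occ_ind w k (w @ z)) u)"
proof -
  let ?e = "\<lambda>i. occurrences w (drop i (w @ u))"
  let ?i = "\<lambda>i. of_bool (?e i = k) :: real"
  let ?g = "\<lambda>q. after (drop (length w - q) w) (\<lambda>z. occ_ind w (Suc k) (w @ z) - occ_ind w k (w @ z)) u"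
  have step: "?e i = ?e (Suc i) + of_bool (prefix w (drop i (w @ u)))" if "i < length w" for i
  proof -
    have "drop i (w @ u) = (w @ u) ! i # drop (Suc i) (w @ u)"
      using that by (intro Cons_nth_drop_Suc[symmetric]) simp
    then show ?thesis by (metis occurrences_Cons)
  qed
  have diff: "?i (Suc q) - ?i q = (if q \<in> periods w then ?g q else 0)" if q: "0 < q" "q < length w" for q
  proof (cases "prefix w (drop q (w @ u))")
    case True
    then have per: "q \<in> periods w" and pre: "prefix (drop (length w - q) w) u"
      using prefix_drop_append_iff[OF q] by auto
    from pre obtain z where z: "u = drop (length w - q) w @ z" by (auto simp: prefix_def)
    have "drop q (w @ u) = w @ z"
      using per q unfolding z by (auto simp: periods_def simp flip: append_assoc)
    then have "?e q = occurrences w (w @ z)" by simp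
    moreover have "?e q = Suc (?e (Suc q))" using step[OF q(2)] True by simp
    ultimately show ?thesis using per pre q
      unfolding z by (auto simp: after_def occ_ind_def)
  next
    case False
    then show ?thesis
      using step[OF q(2)] prefix_drop_append_iff[OF q] by (auto simp: after_def)
  qed
  \<comment> \<open>Position 0 always carries the leading \<open>w\<close> and is left out; the sum
    telescopes over the remaining positions until only \<open>u\<close> is left.\<close>
  have "(\<Sum>q\<in>{1..<length w}. ?i (Suc q) - ?i q) = ?i (length w) - ?i 1"
    using assms by (intro sum_Suc_diff') (simp add: Suc_le_eq)
  moreover have "(\<Sum>q\<in>{1..<length w}. ?i (Suc q) - ?i q) = (\<Sum>q\<in>{1..<length w}. if q \<in> periods w then ?g q else 0)"
    by (intro sum.cong refl diff) auto
  moreover have "\<dots> = (\<Sum>q\<in>periods w. ?g q)"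
    by (subst sum.If_cases) (auto simp: periods_def intro!: sum.cong)
  moreover have "?i 1 = occ_ind w (Suc k) (w @ u)"
    using step[of 0] assms by (simp add: occ_ind_def)
  ultimately show ?thesis by (simp add: occ_ind_def)
qed

text \<open>Dropping the first letter changes the count only for words \<open>u = w @ z\<close>. For
  these, \<open>occ_ind w (Suc k) (w @ z)\<close> is the indicator that the shortened word has count
  \<open>k\<close>, so the last term exchanges it for the indicator of \<open>u\<close>
  itself.\<close>

lemma occ_ind_first_letter:
  fixes b :: nat
  assumes "w \<noteq> []" "set u \<subseteq> {..<b}"
  shows "occ_ind w k u = of_bool (u = [] \<and> k = 0) + (\<Sum>d<b. after [d] (occ_ind w k) u)
     + after w (\<lambda>z. occ_ind w k (w @ z) - occ_ind w (Suc k) (w @ z)) u"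
proof (cases u)
  case Nil
  then show ?thesis using assms by (auto simp: occ_ind_def after_def occurrences_Nil)
next
  case (Cons a u')
  have "(\<Sum>d<b. after [d] (occ_ind w k) u) = (\<Sum>d\<in>{a}. occ_ind w k u')"
    using assms Cons by (intro sum.mono_neutral_cong_right) (auto simp: after_def)
  moreover have "after w (\<lambda>z. occ_ind w k (w @ z) - occ_ind w (Suc k) (w @ z)) u = occ_ind w k u - occ_ind w k u'"
  proof (cases "prefix w u")
    case True
    then obtain z where z: "u = w @ z" by (auto simp: prefix_def)
    have "occurrences w u = Suc (occurrences w u')" using True Cons by (simp add: occurrences_Cons)
    then show ?thesis using z by (auto simp: after_def occ_ind_def)
  next
    case False
    then show ?thesis using Cons by (simp add: after_def occ_ind_def occurrences_Cons)
  qed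
  ultimately show ?thesis using Cons by simp
qed

lemma occ_ind_nonzero_first_letter:
  fixes b :: nat
  assumes "w \<noteq> []" "set u \<subseteq> {..<b}"
  shows "of_bool (u \<noteq> [] \<and> hd u \<noteq> 0) * occ_ind w k u = (\<Sum>d\<in>{1..<b}. after [d] (occ_ind w k) u)
     + of_bool (hd w \<noteq> 0) * after w (\<lambda>z. occ_ind w k (w @ z) - occ_ind w (Suc k) (w @ z)) u"
proof (cases "u = [] \<or> hd u = 0")
  case True
  have "(\<Sum>d\<in>{1..<b}. after [d] (occ_ind w k) u) = 0"
    using True by (intro sum.neutral ballI) (auto simp: after_def prefix_def)
  moreover have "of_bool (hd w \<noteq> 0) * after w \<phi> u = 0" for \<phi>
    using True assms by (auto simp: after_def prefix_def)
  ultimately show ?thesis using True by auto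
next
  case False
  have "b > 0" using False assms by (cases u) auto
  then have "{..<b} = insert 0 {1..<b}" by auto
  moreover have "after [0] (occ_ind w k) u = 0" using False by (auto simp: after_def prefix_def)
  ultimately have "(\<Sum>d<b. after [d] (occ_ind w k) u) = (\<Sum>d\<in>{1..<b}. after [d] (occ_ind w k) u)"
    by simp
  moreover have "of_bool (hd w \<noteq> 0) * after w \<phi> u = after w \<phi> u" for \<phi>
    using False assms by (auto simp: after_def prefix_def)
  ultimately show ?thesis using occ_ind_first_letter[OF assms, of k] False by simp
qed

section \<open>Values of words and transfer operators\<close>

primrec nval :: "nat \<Rightarrow> nat list \<Rightarrow> nat" where
  "nval b [] = 0"
| "nval b (d # u) = d * b ^ length u + nval b u"

lemma nval_append: "nval b (u @ v) = nval b u * b ^ length v + nval b v"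
  by (induction u) (auto simp: algebra_simps power_add)

lemma nval_less: "set u \<subseteq> {..<b} \<Longrightarrow> nval b u < b ^ length u"
proof (induction u)
  case (Cons d u)
  then have "nval b (d # u) < Suc d * b ^ length u" by simp
  also have "\<dots> \<le> b * b ^ length u" using Cons by (intro mult_right_mono) auto
  finally show ?case by simp
qed simp

lemma nval_pos: "u \<noteq> [] \<Longrightarrow> hd u \<noteq> 0 \<Longrightarrow> b > 0 \<Longrightarrow> nval b u > 0"
  by (cases u) auto

lemma nval_ge_power: "u \<noteq> [] \<Longrightarrow> hd u \<noteq> 0 \<Longrightarrow> nval b u \<ge> b ^ (length u - 1)"
  by (cases u) (auto simp: Suc_le_eq intro: trans_le_add1)

lemma base_repr_nval:
  assumes "b \<ge> 2"
  shows "set u \<subseteq> {..<b} \<Longrightarrow> u \<noteq> [] \<Longrightarrow> hd u \<noteq> 0 \<Longrightarrow> base_repr b (nval b u) = u"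
proof (induction u rule: rev_induct)
  case (snoc d u)
  have pos: "nval b (u @ [d]) > 0" using snoc assms by (intro nval_pos) auto
  have v: "nval b (u @ [d]) = nval b u * b + d" by (simp add: nval_append)
  have d: "d < b" using snoc by simp
  have "base_repr b (nval b (u @ [d])) = base_repr b (nval b u) @ [d]"
    using pos assms d by (subst base_repr.simps) (simp add: v)
  also have "base_repr b (nval b u) = u"
  proof (cases "u = []")
    case True
    then show ?thesis by (simp add: base_repr.simps)
  next
    case False
    then show ?thesis using snoc by auto
  qed
  finally show ?case .
qed simp

lemma base_repr_props:
  assumes "b \<ge> 2"
  shows "set (base_repr b n) \<subseteq> {..<b} \<and> nval b (base_repr b n) = n
    \<and> (n > 0 \<longrightarrow> base_repr b n \<noteq> [] \<and> hd (base_repr b n) \<noteq> 0)"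
proof (induction n rule: less_induct)
  case (less n)
  show ?case
  proof (cases "n = 0")
    case True
    then show ?thesis by (simp add: base_repr.simps)
  next
    case False
    have eq: "base_repr b n = base_repr b (n div b) @ [n mod b]"
      using False assms by (subst base_repr.simps) simp
    have IH: "set (base_repr b (n div b)) \<subseteq> {..<b}" "nval b (base_repr b (n div b)) = n div b"
      "n div b > 0 \<longrightarrow> base_repr b (n div b) \<noteq> [] \<and> hd (base_repr b (n div b)) \<noteq> 0"
      using less[of "n div b"] False assms by auto
    have "hd (base_repr b n) \<noteq> 0"
    proof (cases "n div b > 0")
      case True
      then show ?thesis using IH eq by simp
    next
      case div0: False
      then have "base_repr b (n div b) = []" by (simp add: base_repr.simps)
      moreover have "n mod b = n" using div0 by (metis div_mult_mod_eq mult_zero_left add_0 neq0_conv)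
      ultimately show ?thesis using eq False by simp
    qed
    then show ?thesis using IH eq assms by (auto simp: nval_append)
  qed
qed

definition frac_val :: "nat \<Rightarrow> nat list \<Rightarrow> real" where
  "frac_val b u = nval b u / real b ^ length u"

definition block_op :: "nat \<Rightarrow> nat list \<Rightarrow> (real \<Rightarrow> real) \<Rightarrow> real \<Rightarrow> real" where
  "block_op b v f x = f ((real (nval b v) + x) / real b ^ length v) / real b ^ length v"

text \<open>Duality behind the whole method: prefixing \<open>v\<close> to the word amounts to
  applying \<open>block_op b v\<close> to the test function.\<close>

lemma frac_val_append:
  "b > 0 \<Longrightarrow> f (frac_val b (v @ u)) / real b ^ length (v @ u) = block_op b v f (frac_val b u) / real b ^ length u"
  by (simp add: frac_val_def block_op_def nval_append field_simps power_add)

text \<open>The order reverses, because the digits of the operator applied first end up in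
  front.\<close>

lemma block_op_append: "b > 0 \<Longrightarrow> block_op b v (block_op b u f) = block_op b (u @ v) f"
  by (auto simp: block_op_def nval_append field_simps power_add fun_eq_iff)

lemma frac_val_bounds: "set u \<subseteq> {..<b} \<Longrightarrow> frac_val b u \<in> {0..1}"
proof -
  assume u: "set u \<subseteq> {..<b}"
  have "real (nval b u) \<le> real b ^ length u" using nval_less[OF u] by (simp flip: of_nat_power)
  then show ?thesis by (auto simp: frac_val_def divide_le_eq_1)
qed

lemma block_arg_bounds:
  assumes "set v \<subseteq> {..<b}" "x \<in> {0..1}"
  shows "(real (nval b v) + x) / real b ^ length v \<in> {0..1}"
proof -
  have "real (nval b v + 1) \<le> real (b ^ length v)" using nval_less[OF assms(1)] by (simp only: of_nat_le_iff)
  then have "nval b v + x \<le> real b ^ length v" using assms(2) by simp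
  then show ?thesis using assms(2) by (auto simp: divide_le_eq_1)
qed

definition bdd01 :: "(real \<Rightarrow> real) \<Rightarrow> bool" where
  "bdd01 f \<longleftrightarrow> (\<exists>C. \<forall>x\<in>{0..1}. \<bar>f x\<bar> \<le> C)"

lemma bdd01_block_op:
  assumes "bdd01 f" "set v \<subseteq> {..<b}"
  shows "bdd01 (block_op b v f)"
proof -
  obtain C where C: "\<forall>x\<in>{0..1}. \<bar>f x\<bar> \<le> C" using assms(1) by (auto simp: bdd01_def)
  have "\<bar>block_op b v f x\<bar> \<le> C / real b ^ length v" if "x \<in> {0..1}" for x
    using C block_arg_bounds[OF assms(2) that] unfolding block_op_def abs_divide by (simp add: divide_right_mono)
  then show ?thesis unfolding bdd01_def by blast
qed

lemma bdd01_continuous: "continuous_on {0..1} f \<Longrightarrow> bdd01 f"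
proof -
  assume "continuous_on {0..1} f"
  then have "bounded (f ` {0..1})" by (intro compact_imp_bounded compact_continuous_image) auto
  then show ?thesis by (auto simp: bounded_iff bdd01_def)
qed

text \<open>Integral of \<open>f\<close> against the discrete measure with mass
  \<open>\<phi> u / b ^ |u|\<close> at the point 0.u. These points lie in [0,1], so boundedness
  there is all that is asked of test functions.\<close>

definition wsum :: "nat \<Rightarrow> (nat list \<Rightarrow> real) \<Rightarrow> (real \<Rightarrow> real) \<Rightarrow> real" where
  "wsum b \<phi> f = (\<Sum>\<^sub>\<infinity>u\<in>lists {..<b}. \<phi> u * (f (frac_val b u) / real b ^ length u))"

definition finite_mass :: "nat \<Rightarrow> (nat list \<Rightarrow> real) \<Rightarrow> bool" where
  "finite_mass b \<phi> \<longleftrightarrow> (\<forall>u. \<phi> u \<ge> 0) \<and> (\<lambda>u. \<phi> u / real b ^ length u) summable_on lists {..<b}"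

lemma has_sum_wsum:
  assumes "finite_mass b \<phi>" "bdd01 f"
  shows "((\<lambda>u. \<phi> u * (f (frac_val b u) / real b ^ length u)) has_sum wsum b \<phi> f) (lists {..<b})"
proof -
  obtain C where C: "\<forall>x\<in>{0..1}. \<bar>f x\<bar> \<le> C" using assms(2) by (auto simp: bdd01_def)
  have "(\<lambda>u. norm (\<phi> u * (f (frac_val b u) / real b ^ length u))) summable_on lists {..<b}"
  proof (rule summable_on_comparison_test)
    show "(\<lambda>u. C * (\<phi> u / real b ^ length u)) summable_on lists {..<b}"
      using assms(1) by (intro summable_on_cmult_right) (simp add: finite_mass_def)
    fix u assume u: "u \<in> lists {..<b}"
    then have "\<bar>f (frac_val b u)\<bar> \<le> C" using C frac_val_bounds[of u b] by (auto simp: lists_eq_set)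
    then have "\<phi> u / real b ^ length u * \<bar>f (frac_val b u)\<bar> \<le> \<phi> u / real b ^ length u * C"
      using assms(1) by (intro mult_left_mono) (auto simp: finite_mass_def)
    then show "norm (\<phi> u * (f (frac_val b u) / real b ^ length u)) \<le> C * (\<phi> u / real b ^ length u)"
      using assms(1) by (simp add: abs_mult finite_mass_def mult_ac)
  qed simp
  then show ?thesis unfolding wsum_def by (rule has_sum_infsum[OF abs_summable_summable])
qed

lemma has_sum_finite_sum:
  fixes f :: "'i \<Rightarrow> 'a \<Rightarrow> real"
  assumes "finite I" "\<And>i. i \<in> I \<Longrightarrow> (f i has_sum s i) A"
  shows "((\<lambda>x. \<Sum>i\<in>I. f i x) has_sum (\<Sum>i\<in>I. s i)) A"
  using assms by (induction I rule: finite_induct) (auto intro: has_sum_add)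

lemma wsum_sum:
  assumes "finite_mass b \<phi>" "finite I" "\<And>i. i \<in> I \<Longrightarrow> bdd01 (f i)"
  shows "wsum b \<phi> (\<lambda>x. \<Sum>i\<in>I. c i * f i x) = (\<Sum>i\<in>I. c i * wsum b \<phi> (f i))"
proof -
  have "((\<lambda>u. \<Sum>i\<in>I. c i * (\<phi> u * (f i (frac_val b u) / real b ^ length u))) has_sum (\<Sum>i\<in>I. c i * wsum b \<phi> (f i))) (lists {..<b})"
    using assms by (intro has_sum_finite_sum has_sum_cmult_right has_sum_wsum)
  then show ?thesis unfolding wsum_def
    by (intro infsumI) (simp add: sum_distrib_left sum_divide_distrib mult_ac)
qed

lemma wsum_bound:
  assumes "finite_mass b \<phi>" "\<And>x. x \<in> {0..1} \<Longrightarrow> \<bar>f x\<bar> \<le> C"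
  shows "\<bar>wsum b \<phi> f\<bar> \<le> C * wsum b \<phi> (\<lambda>_. 1)"
proof -
  have "bdd01 f" using assms(2) unfolding bdd01_def by blast
  moreover have "bdd01 (\<lambda>_. 1)" unfolding bdd01_def by (intro exI[of _ 1]) simp
  moreover have "norm (\<phi> u * (f (frac_val b u) / real b ^ length u)) \<le> C * (\<phi> u * (1 / real b ^ length u))"
    if "u \<in> lists {..<b}" for u
  proof -
    have "\<bar>f (frac_val b u)\<bar> \<le> C" using that assms(2) frac_val_bounds[of u b] by (auto simp: lists_eq_set)
    then have "\<phi> u / real b ^ length u * \<bar>f (frac_val b u)\<bar> \<le> \<phi> u / real b ^ length u * C"
      using assms(1) by (intro mult_left_mono) (auto simp: finite_mass_def)
    then show ?thesis using assms(1) by (simp add: abs_mult finite_mass_def mult_ac)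
  qed
  ultimately have "norm (wsum b \<phi> f) \<le> C * wsum b \<phi> (\<lambda>_. 1)"
    using norm_infsum_le[OF has_sum_wsum has_sum_cmult_right[OF has_sum_wsum]] assms(1) by blast
  then show ?thesis by simp
qed

lemma has_sum_after:
  assumes "((\<lambda>u. \<phi> u * (block_op b v f (frac_val b u) / real b ^ length u)) has_sum S) (lists {..<b})"
    and "b > 0" "set v \<subseteq> {..<b}"
  shows "((\<lambda>u. after v \<phi> u * (f (frac_val b u) / real b ^ length u)) has_sum S) (lists {..<b})"
proof -
  let ?h = "\<lambda>u. after v \<phi> u * (f (frac_val b u) / real b ^ length u)"
  have "((\<lambda>u. ?h (v @ u)) has_sum S) (lists {..<b})"
    using assms(1) unfolding frac_val_append[OF assms(2)] by (simp add: after_def)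
  then have "(?h has_sum S) ((@) v ` lists {..<b})"
    by (subst has_sum_reindex) (simp_all only: o_def inj_on_def, simp_all)
  also have "?this \<longleftrightarrow> ?thesis"
    using assms(3) by (intro has_sum_cong_neutral) (auto simp: after_def prefix_def image_iff)
  finally show ?thesis .
qed

section \<open>Weighted sums over words\<close>

lemma has_sum_minus:
  fixes f g :: "'a \<Rightarrow> real"
  assumes "(f has_sum s) A" "(g has_sum t) A"
  shows "((\<lambda>x. f x - g x) has_sum (s - t)) A"
  using has_sum_add[OF assms(1) has_sum_uminusI[OF assms(2)]] by simp

locale block =
  fixes b :: nat and w :: "nat list"
  assumes b_ge2: "b \<ge> 2" and w_ne: "w \<noteq> []" and w_digits: "set w \<subseteq> {..<b}"
begin

lemma b_pos: "b > 0" using b_ge2 by simp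

section \<open>Summability of the words with a given number of blocks\<close>

definition level_mass :: "nat \<Rightarrow> real" where
  "level_mass n = (\<Sum>u\<in>{u. set u \<subseteq> {..<b} \<and> length u = n}. (1/2) ^ occurrences w u / real b ^ n)"

lemma finite_level: "finite {u. set u \<subseteq> {..<b} \<and> length u = n}"
  by (rule finite_lists_length_eq) simp

lemma level_mass_nonneg: "level_mass n \<ge> 0"
  unfolding level_mass_def by (intro sum_nonneg) auto

lemma level_mass_le_1: "level_mass n \<le> 1"
proof -
  have "level_mass n \<le> (\<Sum>u\<in>{u. set u \<subseteq> {..<b} \<and> length u = n}. 1 / real b ^ n)"
    unfolding level_mass_def by (intro sum_mono divide_right_mono power_le_one) auto
  also have "\<dots> = 1"
    using b_pos card_lists_length_eq[of "{..<b}" n] by simp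
  finally show ?thesis .
qed

text \<open>Cutting a word in two can only lose blocks, and every block contributes a factor 1/2, so
  the masses are submultiplicative.\<close>

lemma level_mass_add: "level_mass (m + n) \<le> level_mass m * level_mass n"
proof -
  let ?L = "\<lambda>n. {u. set u \<subseteq> {..<b} \<and> length u = n}"
  have "level_mass (m + n) = (\<Sum>(u, v)\<in>?L m \<times> ?L n. (1/2) ^ occurrences w (u @ v) / real b ^ (m + n))"
    unfolding level_mass_def
    by (rule sum.reindex_bij_witness[of _ "\<lambda>(u, v). u @ v" "\<lambda>x. (take m x, drop m x)"])
       (auto dest: in_set_takeD in_set_dropD)
  also have "\<dots> \<le> (\<Sum>(u, v)\<in>?L m \<times> ?L n. ((1/2) ^ occurrences w u / real b ^ m) * ((1/2) ^ occurrences w v / real b ^ n))"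
  proof (rule sum_mono)
    fix x assume "x \<in> ?L m \<times> ?L n"
    then obtain u v where x: "x = (u, v)" "length u = m" "length v = n" by auto
    have "(1/2::real) ^ occurrences w (u @ v) \<le> (1/2) ^ (occurrences w u + occurrences w v)"
      by (intro power_decreasing occurrences_append_ge w_ne) auto
    then have "(1/2::real) ^ occurrences w (u @ v) / real b ^ (m + n)
      \<le> (1/2) ^ (occurrences w u + occurrences w v) / real b ^ (m + n)"
      by (intro divide_right_mono) auto
    then show "(case x of (u, v) \<Rightarrow> (1/2) ^ occurrences w (u @ v) / real b ^ (m + n))
      \<le> (case x of (u, v) \<Rightarrow> ((1/2) ^ occurrences w u / real b ^ m) * ((1/2) ^ occurrences w v / real b ^ n))"
      using x by (simp add: power_add)
  qed
  also have "\<dots> = level_mass m * level_mass n"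
    unfolding level_mass_def sum_product sum.cartesian_product by simp
  finally show ?thesis .
qed

lemma level_mass_less_1: "level_mass (length w) < 1"
proof -
  let ?L = "{u. set u \<subseteq> {..<b} \<and> length u = length w}"
  have "occurrences w w \<ge> 1" using occurrences_self[OF w_ne, of "[]"] by simp
  then have ww: "(1/2::real) ^ occurrences w w < 1" using power_strict_decreasing[of 0 "occurrences w w" "1/2::real"] by simp
  have "level_mass (length w) < (\<Sum>u\<in>?L. 1 / real b ^ length w)"
    unfolding level_mass_def
    using ww w_digits b_pos
    by (intro sum_strict_mono_ex1 finite_level ballI divide_right_mono power_le_one bexI[of _ w] divide_strict_right_mono) auto
  also have "\<dots> = 1"
    using b_pos card_lists_length_eq[of "{..<b}" "length w"] by simp
  finally show ?thesis .
qed

text \<open>A shift by \<open>length w\<close> costs the factor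
  \<open>A = level_mass (length w) < 1\<close>, so the partial sum \<open>S\<close> satisfies
  \<open>S \<le> length w + A * S\<close>.\<close>

lemma level_mass_partial_sums:
  "(\<Sum>n<N. level_mass n) \<le> length w / (1 - level_mass (length w))"
proof -
  let ?p = "length w" and ?A = "level_mass (length w)"
  let ?S = "\<Sum>n<N. level_mass n"
  have "?S \<le> (\<Sum>n<N + ?p. level_mass n)"
    by (intro sum_mono2) (auto intro: level_mass_nonneg)
  also have "\<dots> = (\<Sum>n<?p. level_mass n) + (\<Sum>n<N. level_mass (?p + n))"
    using sum.atLeastLessThan_concat[of 0 ?p "?p + N" level_mass]
      sum.shift_bounds_nat_ivl[of level_mass 0 ?p N] by (simp add: lessThan_atLeast0 add.commute)
  also have "\<dots> \<le> (\<Sum>n<?p. 1) + (\<Sum>n<N. ?A * level_mass n)"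
    by (intro add_mono sum_mono level_mass_le_1 level_mass_add)
  also have "\<dots> = ?p + ?A * ?S" by (simp add: sum_distrib_left)
  finally show ?thesis using level_mass_less_1 by (simp add: field_simps)
qed

lemma summable_half_weight:
  "(\<lambda>u. (1/2) ^ occurrences w u / real b ^ length u) summable_on lists {..<b}"
proof (rule nonneg_bdd_above_summable_on)
  let ?g = "\<lambda>u. (1/2::real) ^ occurrences w u / real b ^ length u"
  show "bdd_above (sum ?g ` {F. F \<subseteq> lists {..<b} \<and> finite F})"
  proof (rule bdd_aboveI2)
    fix F assume "F \<in> {F. F \<subseteq> lists {..<b} \<and> finite F}"
    then have F: "F \<subseteq> lists {..<b}" "finite F" by auto
    define N where "N = Suc (Max (insert 0 (length ` F)))"
    have "F \<subseteq> (\<Union>n<N. {u. set u \<subseteq> {..<b} \<and> length u = n})"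
    proof
      fix u assume u: "u \<in> F"
      then have "length u < N" unfolding N_def less_Suc_eq_le using F by (intro Max_ge) auto
      then show "u \<in> (\<Union>n<N. {u. set u \<subseteq> {..<b} \<and> length u = n})"
        using u F by auto
    qed
    then have "sum ?g F \<le> sum ?g (\<Union>n<N. {u. set u \<subseteq> {..<b} \<and> length u = n})"
      using finite_level by (intro sum_mono2) auto
    also have "\<dots> = (\<Sum>n<N. level_mass n)"
      unfolding level_mass_def using finite_level by (subst sum.UNION_disjoint) (auto intro!: sum.cong)
    also have "\<dots> \<le> length w / (1 - level_mass (length w))" by (rule level_mass_partial_sums)
    finally show "sum ?g F \<le> length w / (1 - level_mass (length w))" .
  qed
qed auto

text \<open>Geometric damping of the count treats all \<open>k\<close> at once: a word with at most
  \<open>k\<close> blocks has \<open>1 \<le> 2 ^ k * (1/2) ^ occurrences w u\<close>.\<close>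

lemma finite_massI:
  assumes "\<And>u. \<phi> u \<ge> 0" "\<And>u. \<phi> u \<le> 2 ^ k * (1/2) ^ occurrences w u"
  shows "finite_mass b \<phi>"
proof -
  have "(\<lambda>u. \<phi> u / real b ^ length u) summable_on lists {..<b}"
  proof (rule summable_on_comparison_test)
    show "(\<lambda>u. 2 ^ k * ((1/2) ^ occurrences w u / real b ^ length u)) summable_on lists {..<b}"
      by (intro summable_on_cmult_right summable_half_weight)
    show "\<phi> u / real b ^ length u \<le> 2 ^ k * ((1/2) ^ occurrences w u / real b ^ length u)" for u
      using assms(2)[of u] by (simp add: divide_right_mono)
  qed (use assms(1) in auto)
  then show ?thesis using assms(1) by (simp add: finite_mass_def)
qed

lemma half_power_bound: "m \<le> k \<Longrightarrow> 1 \<le> 2 ^ k * (1/2::real) ^ m"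
  using power_decreasing[of m k "1/2::real"] by (simp add: power_one_over field_simps)

section \<open>The functionals for exactly \<open>k\<close> blocks and their recurrences\<close>

definition free_sum :: "nat \<Rightarrow> (real \<Rightarrow> real) \<Rightarrow> real" where
  "free_sum k = wsum b (occ_ind w k)"

text \<open>The functional \<open>r k\<close> of the overview; \<open>free_sum\<close> is its
  analogue without the leading \<open>w\<close>.\<close>

definition block_sum :: "nat \<Rightarrow> (real \<Rightarrow> real) \<Rightarrow> real" where
  "block_sum k = wsum b (\<lambda>u. occ_ind w k (w @ u))"

lemma finite_mass_free: "finite_mass b (occ_ind w k)"
  by (rule finite_massI[of _ k]) (auto simp: occ_ind_def half_power_bound)

lemma finite_mass_block: "finite_mass b (\<lambda>u. occ_ind w k (w @ u))"
proof (rule finite_massI[of _ k])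
  fix u show "occ_ind w k (w @ u) \<le> 2 ^ k * (1/2) ^ occurrences w u"
    using occurrences_append_ge[OF w_ne, of w u] by (auto simp: occ_ind_def half_power_bound)
qed (auto simp: occ_ind_def)

lemmas has_sum_free = has_sum_wsum[OF finite_mass_free, folded free_sum_def]
lemmas has_sum_block = has_sum_wsum[OF finite_mass_block, folded block_sum_def]

lemma block_sum_0: "block_sum 0 f = 0"
  unfolding block_sum_def wsum_def by (simp add: occ_ind_def occurrences_self w_ne)

text \<open>The suffix \<open>v q\<close> of the overview: the letters which a copy of
  \<open>w\<close> shifted by \<open>q\<close> adds to the first copy.\<close>

definition tail :: "nat \<Rightarrow> nat list" where
  "tail q = drop (length w - q) w"

lemma tail_digits: "set (tail q) \<subseteq> {..<b}"
  using w_digits by (auto simp: tail_def dest: in_set_dropD)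

lemma has_sum_after_diff:
  assumes "bdd01 (block_op b v f)" "set v \<subseteq> {..<b}"
  shows "((\<lambda>u. after v (\<lambda>z. occ_ind w k (w @ z) - occ_ind w l (w @ z)) u * (f (frac_val b u) / real b ^ length u))
    has_sum (block_sum k (block_op b v f) - block_sum l (block_op b v f))) (lists {..<b})"
proof (rule has_sum_after[OF _ b_pos assms(2)])
  show "((\<lambda>u. (occ_ind w k (w @ u) - occ_ind w l (w @ u)) * (block_op b v f (frac_val b u) / real b ^ length u))
    has_sum (block_sum k (block_op b v f) - block_sum l (block_op b v f))) (lists {..<b})"
    using has_sum_minus[OF has_sum_block[OF assms(1), of k] has_sum_block[OF assms(1), of l]]
    by (simp only: left_diff_distrib)
qed

lemma free_sum_eq_block_sum:
  assumes "bdd01 f"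
  shows "free_sum k f = block_sum (Suc k) f + (\<Sum>q\<in>periods w.
    block_sum (Suc k) (block_op b (tail q) f) - block_sum k (block_op b (tail q) f))"
proof (rule has_sum_unique[OF has_sum_free[OF assms, of k]])
  have "((\<lambda>u. occ_ind w (Suc k) (w @ u) * (f (frac_val b u) / real b ^ length u) +
     (\<Sum>q\<in>periods w. after (tail q) (\<lambda>z. occ_ind w (Suc k) (w @ z) - occ_ind w k (w @ z)) u * (f (frac_val b u) / real b ^ length u)))
    has_sum (block_sum (Suc k) f + (\<Sum>q\<in>periods w.
    block_sum (Suc k) (block_op b (tail q) f) - block_sum k (block_op b (tail q) f)))) (lists {..<b})"
    by (intro has_sum_add has_sum_finite_sum has_sum_block has_sum_after_diff assms bdd01_block_op tail_digits finite_periods)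
  also have "?this \<longleftrightarrow> ((\<lambda>u. occ_ind w k u * (f (frac_val b u) / real b ^ length u)) has_sum (block_sum (Suc k) f + (\<Sum>q\<in>periods w.
    block_sum (Suc k) (block_op b (tail q) f) - block_sum k (block_op b (tail q) f)))) (lists {..<b})"
  proof (rule has_sum_cong)
    fix u
    from occ_ind_periods[OF w_ne, of k u, folded tail_def]
    show "occ_ind w (Suc k) (w @ u) * (f (frac_val b u) / real b ^ length u) +
     (\<Sum>q\<in>periods w. after (tail q) (\<lambda>z. occ_ind w (Suc k) (w @ z) - occ_ind w k (w @ z)) u * (f (frac_val b u) / real b ^ length u))
      = occ_ind w k u * (f (frac_val b u) / real b ^ length u)"
      by (simp only: distrib_right sum_distrib_right)
  qed
  finally show "((\<lambda>u. occ_ind w k u * (f (frac_val b u) / real b ^ length u)) has_sum (block_sum (Suc k) f + (\<Sum>q\<in>periods w.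
    block_sum (Suc k) (block_op b (tail q) f) - block_sum k (block_op b (tail q) f)))) (lists {..<b})" .
qed

text \<open>\<open>occ_ind_first_letter\<close> summed against the weight; the empty word, with
  value 0, supplies the term \<open>f 0\<close> for \<open>k = 0\<close>.\<close>

lemma free_sum_first_letter:
  assumes "bdd01 f"
  shows "free_sum k f = of_bool (k = 0) * f 0 + (\<Sum>d<b. free_sum k (block_op b [d] f))
    + (block_sum k (block_op b w f) - block_sum (Suc k) (block_op b w f))"
proof (rule has_sum_unique[OF has_sum_free[OF assms, of k]])
  let ?W = "\<lambda>u. f (frac_val b u) / real b ^ length u"
  let ?S = "of_bool (k = 0) * f 0 + (\<Sum>d<b. free_sum k (block_op b [d] f))
    + (block_sum k (block_op b w f) - block_sum (Suc k) (block_op b w f))"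
  have "((\<lambda>u. of_bool (u = [] \<and> k = 0) * ?W u) has_sum (of_bool (k = 0) * f 0)) (lists {..<b})"
    by (rule has_sum_finite_neutralI[of "{[]}"]) (auto simp: frac_val_def)
  moreover have "((\<lambda>u. \<Sum>d<b. after [d] (occ_ind w k) u * ?W u) has_sum (\<Sum>d<b. free_sum k (block_op b [d] f))) (lists {..<b})"
    by (intro has_sum_finite_sum has_sum_after has_sum_free b_pos assms bdd01_block_op) auto
  moreover have "((\<lambda>u. after w (\<lambda>z. occ_ind w k (w @ z) - occ_ind w (Suc k) (w @ z)) u * ?W u) has_sum
     (block_sum k (block_op b w f) - block_sum (Suc k) (block_op b w f))) (lists {..<b})"
    by (intro has_sum_after_diff assms bdd01_block_op w_digits)
  ultimately have "((\<lambda>u. of_bool (u = [] \<and> k = 0) * ?W u + (\<Sum>d<b. after [d] (occ_ind w k) u * ?W u) +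
      after w (\<lambda>z. occ_ind w k (w @ z) - occ_ind w (Suc k) (w @ z)) u * ?W u) has_sum ?S) (lists {..<b})"
    by (intro has_sum_add)
  also have "?this \<longleftrightarrow> ((\<lambda>u. occ_ind w k u * ?W u) has_sum ?S) (lists {..<b})"
  proof (rule has_sum_cong)
    fix u assume "u \<in> lists {..<b}"
    then have "set u \<subseteq> {..<b}" by (auto simp: lists_eq_set)
    from occ_ind_first_letter[OF w_ne this, of k]
    show "of_bool (u = [] \<and> k = 0) * ?W u + (\<Sum>d<b. after [d] (occ_ind w k) u * ?W u) +
      after w (\<lambda>z. occ_ind w k (w @ z) - occ_ind w (Suc k) (w @ z)) u * ?W u = occ_ind w k u * ?W u"
      by (simp only: distrib_right sum_distrib_right)
  qed
  finally show "((\<lambda>u. occ_ind w k u * ?W u) has_sum ?S) (lists {..<b})" .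
qed

section \<open>Harmonic sums as values of the functionals at reciprocals\<close>

definition recip :: "real \<Rightarrow> real \<Rightarrow> real" where
  "recip n x = 1 / (n + x)"

lemma bdd01_recip: "n > 0 \<Longrightarrow> bdd01 (recip n)"
  unfolding recip_def by (intro bdd01_continuous continuous_intros) auto

text \<open>Reciprocals are closed under all block operators: the digits of \<open>v\<close> are
  appended to the integer \<open>n\<close>.\<close>

lemma block_op_recip: "block_op b v (recip n) = recip (n * real b ^ length v + real (nval b v))"
  using b_pos by (auto simp: block_op_def recip_def fun_eq_iff divide_simps)

text \<open>For the representation \<open>u\<close> of \<open>n\<close>, the term
  \<open>1 / n\<close> is \<open>recip 0\<close> at 0.u divided by \<open>b ^ |u|\<close>, and the
  sum is split by the first digit. \<open>recip 0\<close> itself is unbounded on [0,1], but it only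
  enters behind a prefix with nonzero first digit, which makes the shift positive.\<close>

lemma I_sum_eq:
  "I_sum b w k = (\<Sum>d\<in>{1..<b}. free_sum k (recip (real d)))
    + of_bool (hd w \<noteq> 0) * (block_sum k (recip (nval b w)) - block_sum (Suc k) (recip (nval b w)))"
proof -
  let ?W = "\<lambda>u. recip 0 (frac_val b u) / real b ^ length u"
  let ?S = "(\<Sum>d\<in>{1..<b}. free_sum k (recip (real d)))
    + of_bool (hd w \<noteq> 0) * (block_sum k (recip (nval b w)) - block_sum (Suc k) (recip (nval b w)))"
  let ?M = "{u \<in> lists {..<b}. u \<noteq> [] \<and> hd u \<noteq> 0 \<and> occurrences w u = k}"
  have "bdd01 (block_op b v (recip 0))" if "v \<noteq> []" "hd v \<noteq> 0" for v
    using nval_pos[OF that b_pos] by (auto simp: block_op_recip intro: bdd01_recip)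
  note bdd = this
  have "((\<lambda>u. \<Sum>d\<in>{1..<b}. after [d] (occ_ind w k) u * ?W u) has_sum (\<Sum>d\<in>{1..<b}. free_sum k (block_op b [d] (recip 0)))) (lists {..<b})"
    by (intro has_sum_finite_sum has_sum_after has_sum_free b_pos bdd) auto
  then have 1: "((\<lambda>u. \<Sum>d\<in>{1..<b}. after [d] (occ_ind w k) u * ?W u) has_sum (\<Sum>d\<in>{1..<b}. free_sum k (recip (real d)))) (lists {..<b})"
    by (simp add: block_op_recip)
  have 2: "((\<lambda>u. of_bool (hd w \<noteq> 0) * (after w (\<lambda>z. occ_ind w k (w @ z) - occ_ind w (Suc k) (w @ z)) u * ?W u)) has_sum
     of_bool (hd w \<noteq> 0) * (block_sum k (recip (nval b w)) - block_sum (Suc k) (recip (nval b w)))) (lists {..<b})"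
  proof (cases "hd w = 0")
    case False
    show ?thesis
      using has_sum_after_diff[OF bdd[OF w_ne False] w_digits, of k "Suc k"] False by (simp add: block_op_recip)
  qed simp
  have "((\<lambda>u. (\<Sum>d\<in>{1..<b}. after [d] (occ_ind w k) u * ?W u) +
    of_bool (hd w \<noteq> 0) * (after w (\<lambda>z. occ_ind w k (w @ z) - occ_ind w (Suc k) (w @ z)) u * ?W u)) has_sum ?S) (lists {..<b})"
    by (rule has_sum_add[OF 1 2])
  also have "?this \<longleftrightarrow> ((\<lambda>u. 1 / real (nval b u)) has_sum ?S) ?M"
  proof (rule has_sum_cong_neutral)
    have *: "(\<Sum>d\<in>{1..<b}. after [d] (occ_ind w k) u * ?W u) +
      of_bool (hd w \<noteq> 0) * (after w (\<lambda>z. occ_ind w k (w @ z) - occ_ind w (Suc k) (w @ z)) u * ?W u)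
      = of_bool (u \<noteq> [] \<and> hd u \<noteq> 0) * occ_ind w k u * ?W u" if "u \<in> lists {..<b}" for u
    proof -
      have "set u \<subseteq> {..<b}" using that by (auto simp: lists_eq_set)
      from occ_ind_nonzero_first_letter[OF w_ne this, of k]
      show ?thesis by (simp only: distrib_right sum_distrib_right mult.assoc)
    qed
    show "(\<Sum>d\<in>{1..<b}. after [d] (occ_ind w k) u * ?W u) +
      of_bool (hd w \<noteq> 0) * (after w (\<lambda>z. occ_ind w k (w @ z) - occ_ind w (Suc k) (w @ z)) u * ?W u) = 0"
      if "u \<in> lists {..<b} - ?M" for u
      using that by (subst *) (auto simp: occ_ind_def)
    show "(\<Sum>d\<in>{1..<b}. after [d] (occ_ind w k) u * ?W u) +
      of_bool (hd w \<noteq> 0) * (after w (\<lambda>z. occ_ind w k (w @ z) - occ_ind w (Suc k) (w @ z)) u * ?W u) = 1 / real (nval b u)"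
      if "u \<in> lists {..<b} \<inter> ?M" for u
      using that b_pos by (subst *) (auto simp: occ_ind_def recip_def frac_val_def)
  qed auto
  also have "\<dots> \<longleftrightarrow> ((\<lambda>n. 1 / real n) has_sum ?S) {n. n > 0 \<and> block_count b w n = k}"
    by (rule has_sum_reindex_bij_witness[of _ "base_repr b" "nval b"])
       (use base_repr_props[OF b_ge2] base_repr_nval[OF b_ge2] nval_pos b_pos in
         \<open>auto simp: block_count_def lists_eq_set\<close>)
  finally show ?thesis unfolding I_sum_def by (rule infsumI)
qed

end

section \<open>Moments and eigenvalues\<close>

context block
begin

text \<open>The value \<open>length w\<close> stands for the absence of self-overlaps;
  \<open>center\<close> is then the fixed point belonging to \<open>w\<close> itself.\<close>

definition min_period :: nat where
  "min_period = Min (insert (length w) (periods w))"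

definition center :: real where
  "center = nval b (tail min_period) / (real b ^ min_period - 1)"

definition shift :: "nat list \<Rightarrow> real" where
  "shift v = (real (nval b v) + center) / real b ^ length v - center"

text \<open>One letter acts on degree \<open>m\<close> by \<open>1 / b ^ m\<close> from the argument
  and \<open>1 / b\<close> from the outer factor.\<close>

definition zpt :: "nat \<Rightarrow> real" where
  "zpt m = 1 / real b ^ Suc m"

definition op_coeff :: "nat list \<Rightarrow> nat \<Rightarrow> nat \<Rightarrow> real" where
  "op_coeff v m l = real (m choose l) * shift v ^ (m - l) * zpt l ^ length v"

definition cpow :: "nat \<Rightarrow> real \<Rightarrow> real" where
  "cpow m x = (x - center) ^ m"

lemma block_op_cpow: "block_op b v (cpow m) x = (\<Sum>l\<le>m. op_coeff v m l * cpow l x)"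
proof -
  let ?B = "real b ^ length v"
  have B: "?B \<noteq> 0" using b_pos by simp
  have "(real (nval b v) + x) / ?B - center = (x - center) / ?B + shift v"
    by (simp add: shift_def add_divide_distrib diff_divide_distrib)
  then have "block_op b v (cpow m) x = (\<Sum>l\<le>m. real (m choose l) * ((x - center) / ?B) ^ l * shift v ^ (m - l)) / ?B"
    by (simp add: block_op_def cpow_def binomial_ring)
  also have "\<dots> = (\<Sum>l\<le>m. op_coeff v m l * cpow l x)"
    unfolding sum_divide_distrib
  proof (rule sum.cong)
    fix l
    have "zpt l ^ length v = 1 / (?B ^ l * ?B)"
      by (simp add: zpt_def power_divide power_mult_distrib flip: power_mult power_add) (simp add: algebra_simps)
    then show "real (m choose l) * ((x - center) / ?B) ^ l * shift v ^ (m - l) / ?B = op_coeff v m l * cpow l x"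
      by (simp add: op_coeff_def cpow_def power_divide)
  qed simp
  finally show ?thesis .
qed

lemma bdd01_cpow: "bdd01 (cpow m)"
  unfolding cpow_def by (intro bdd01_continuous continuous_intros)

definition mom :: "nat \<Rightarrow> nat \<Rightarrow> real" where
  "mom k m = block_sum k (cpow m)"

lemma block_sum_block_op_cpow: "block_sum k (block_op b v (cpow m)) = (\<Sum>l\<le>m. op_coeff v m l * mom k l)"
proof -
  have "block_op b v (cpow m) = (\<lambda>x. \<Sum>l\<le>m. op_coeff v m l * cpow l x)"
    by (simp add: block_op_cpow fun_eq_iff)
  then show ?thesis
    unfolding block_sum_def mom_def by (simp add: wsum_sum[OF finite_mass_block] bdd01_cpow)
qed

definition Acoeff :: "nat \<Rightarrow> nat \<Rightarrow> real" where
  "Acoeff m l = (\<Sum>d<b. op_coeff [d] m l)"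

text \<open>Matrix of the operator \<open>B\<close> in the basis \<open>cpow\<close>; the word
  \<open>d # tail q\<close> appears because the operator of \<open>[d]\<close> followed by that of
  \<open>tail q\<close> is the operator of this word.\<close>

definition Bcoeff :: "nat \<Rightarrow> nat \<Rightarrow> real" where
  "Bcoeff m l = op_coeff w m l + (\<Sum>q\<in>periods w. op_coeff (tail q) m l - (\<Sum>d<b. op_coeff (d # tail q) m l))"

definition Pcoeff :: "nat \<Rightarrow> nat \<Rightarrow> real" where
  "Pcoeff m l = of_bool (l = m) - Acoeff m l + Bcoeff m l"

text \<open>Inserting the overlap identity for \<open>f\<close> and for each
  \<open>block_op b [d] f\<close> into the first-letter identity eliminates \<open>free_sum\<close>
  and leaves a recurrence in \<open>k\<close> for \<open>block_sum\<close> alone.\<close>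

lemma block_sum_recurrence:
  fixes k :: nat
  assumes "bdd01 f"
  defines "\<Delta> \<equiv> \<lambda>v. block_sum (Suc k) (block_op b v f) - block_sum k (block_op b v f)"
  shows "block_sum (Suc k) f - (\<Sum>d<b. block_sum (Suc k) (block_op b [d] f))
    + (\<Delta> w + (\<Sum>q\<in>periods w. \<Delta> (tail q) - (\<Sum>d<b. \<Delta> (d # tail q)))) = of_bool (k = 0) * f 0"
proof -
  have "free_sum k (block_op b [d] f) = block_sum (Suc k) (block_op b [d] f) + (\<Sum>q\<in>periods w. \<Delta> (d # tail q))"
    if "d < b" for d
    using free_sum_eq_block_sum[OF bdd01_block_op[OF assms(1), of "[d]" b], of k] that
    by (simp add: \<Delta>_def block_op_append b_pos)
  then have "(\<Sum>d<b. free_sum k (block_op b [d] f)) =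
      (\<Sum>d<b. block_sum (Suc k) (block_op b [d] f)) + (\<Sum>q\<in>periods w. \<Sum>d<b. \<Delta> (d # tail q))"
    by (simp add: sum.distrib sum.swap[of _ "periods w"])
  then show ?thesis
    using free_sum_first_letter[OF assms(1), of k] free_sum_eq_block_sum[OF assms(1), of k]
    by (simp add: \<Delta>_def sum_subtractf)
qed

text \<open>The recurrence on \<open>cpow m\<close>: only moments of degree at most \<open>m\<close>
  occur, so the system is triangular. The inhomogeneous term is \<open>cpow m 0\<close>.\<close>

lemma mom_recurrence:
  "(\<Sum>l\<le>m. Pcoeff m l * mom (Suc k) l) = (\<Sum>l\<le>m. Bcoeff m l * mom k l) + of_bool (k = 0) * (- center) ^ m"
proof -
  let ?D = "\<lambda>l. mom (Suc k) l - mom k l"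
  have \<Delta>: "block_sum (Suc k) (block_op b v (cpow m)) - block_sum k (block_op b v (cpow m)) = (\<Sum>l\<le>m. op_coeff v m l * ?D l)" for v
    by (simp add: block_sum_block_op_cpow sum_subtractf right_diff_distrib)
  have swap: "(\<Sum>d<b. \<Sum>l\<le>m. g d l * h l) = (\<Sum>l\<le>m. (\<Sum>d<b. g d l) * h l)" for g :: "nat \<Rightarrow> nat \<Rightarrow> real" and h
    by (subst sum.swap) (simp add: sum_distrib_right)
  have swap': "(\<Sum>q\<in>periods w. \<Sum>l\<le>m. g q l * h l) = (\<Sum>l\<le>m. (\<Sum>q\<in>periods w. g q l) * h l)" for g :: "nat \<Rightarrow> nat \<Rightarrow> real" and h
    by (subst sum.swap) (simp add: sum_distrib_right)
  have "mom (Suc k) m - (\<Sum>l\<le>m. Acoeff m l * mom (Suc k) l) + (\<Sum>l\<le>m. Bcoeff m l * ?D l) = of_bool (k = 0) * (- center) ^ m"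
    using block_sum_recurrence[OF bdd01_cpow, of k m]
    unfolding \<Delta> unfolding block_sum_block_op_cpow mom_def[symmetric] swap sum_subtractf[symmetric] left_diff_distrib[symmetric]
      swap' sum.distrib[symmetric] distrib_right[symmetric] Acoeff_def[symmetric] Bcoeff_def[symmetric]
    by (simp add: cpow_def)
  moreover have "mom (Suc k) m = (\<Sum>l\<le>m. of_bool (l = m) * mom (Suc k) l)"
    by (simp add: of_bool_def if_distrib[of "\<lambda>x. x * _"] sum.delta cong: if_cong)
  moreover have "(\<Sum>l\<le>m. Pcoeff m l * mom (Suc k) l) = (\<Sum>l\<le>m. of_bool (l = m) * mom (Suc k) l)
      - (\<Sum>l\<le>m. Acoeff m l * mom (Suc k) l) + (\<Sum>l\<le>m. Bcoeff m l * mom (Suc k) l)"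
    by (simp only: Pcoeff_def distrib_right left_diff_distrib sum.distrib sum_subtractf)
  ultimately show ?thesis
    unfolding right_diff_distrib sum_subtractf by linarith
qed

lemma length_tail: "q \<le> length w \<Longrightarrow> length (tail q) = q"
  by (simp add: tail_def)

lemma periods_bounds: "q \<in> periods w \<Longrightarrow> 0 < q \<and> q < length w"
  by (auto simp: periods_def)

section \<open>Diagonal entries and eigenvalues\<close>

definition Qsum :: "nat \<Rightarrow> real" where
  "Qsum m = (\<Sum>q\<in>periods w. zpt m ^ q)"

lemma op_coeff_diag: "op_coeff v m m = zpt m ^ length v"
  by (simp add: op_coeff_def)

lemma Bcoeff_diag: "Bcoeff m m = zpt m ^ length w + (1 - b * zpt m) * Qsum m"
proof -
  have "(\<Sum>q\<in>periods w. op_coeff (tail q) m m - (\<Sum>d<b. op_coeff (d # tail q) m m))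
    = (\<Sum>q\<in>periods w. (1 - b * zpt m) * zpt m ^ q)"
    by (intro sum.cong refl) (auto simp: op_coeff_diag length_tail algebra_simps dest: periods_bounds)
  then show ?thesis by (simp add: Bcoeff_def op_coeff_diag Qsum_def sum_distrib_left)
qed

lemma Pcoeff_diag: "Pcoeff m m = 1 - b * zpt m + Bcoeff m m"
  by (simp add: Pcoeff_def Acoeff_def op_coeff_diag)

text \<open>Numbered by the degree, so \<open>eig m\<close> is the eigenvalue with index
  \<open>m + 1\<close> of the theorem: the factor by which the degree \<open>m\<close> part of the
  recurrence multiplies at each step in \<open>k\<close>.\<close>

definition eig :: "nat \<Rightarrow> real" where
  "eig m = Bcoeff m m / Pcoeff m m"

lemma zpt_pos: "zpt m > 0" using b_pos by (simp add: zpt_def)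

lemma b_zpt: "b * zpt m = (1 / b) ^ m"
  using b_pos by (simp add: zpt_def power_divide)

lemma b_zpt_le_1: "b * zpt m \<le> 1"
  unfolding b_zpt using b_ge2 by (intro power_le_one) auto

lemma b_zpt_le: "m > 0 \<Longrightarrow> b * zpt m \<le> 1/2"
proof -
  assume "m > 0"
  then have "(1 / real b) ^ m \<le> (1/2) ^ 1"
    using b_ge2 by (intro order.trans[OF power_mono[of _ "1/2"] power_decreasing]) (auto simp: divide_simps)
  then show ?thesis unfolding b_zpt by simp
qed

lemma b_zpt_le': "m \<ge> 2 \<Longrightarrow> b * zpt m \<le> 1/4"
proof -
  assume "m \<ge> 2"
  then have "(1 / real b) ^ m \<le> (1/2) ^ 2"
    using b_ge2 by (intro order.trans[OF power_mono[of _ "1/2"] power_decreasing]) (auto simp: divide_simps)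
  then show ?thesis unfolding b_zpt by (simp add: power2_eq_square)
qed

lemma zpt_half: "j < m \<Longrightarrow> zpt m \<le> zpt j / 2"
proof -
  assume "j < m"
  then have "real b ^ Suc m \<ge> real b ^ Suc (Suc j)" using b_ge2 by (intro power_increasing) auto
  moreover have "real b ^ Suc (Suc j) \<ge> 2 * real b ^ Suc j" using b_ge2 by simp
  ultimately have "real b ^ Suc m \<ge> 2 * real b ^ Suc j" by linarith
  then show ?thesis using b_pos unfolding zpt_def by (simp add: divide_simps)
qed

lemma zpt_power_half: "j < m \<Longrightarrow> q > 0 \<Longrightarrow> zpt m ^ q \<le> zpt j ^ q / 2"
proof -
  assume "j < m" "q > 0"
  then have "zpt m ^ q \<le> (zpt j / 2) ^ q" using zpt_half zpt_pos[of m] by (intro power_mono) auto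
  also have "\<dots> = zpt j ^ q * (1/2) ^ q" by (simp add: power_divide)
  also have "\<dots> \<le> zpt j ^ q * (1/2) ^ 1"
    using \<open>q > 0\<close> zpt_pos[of j] by (intro mult_left_mono power_decreasing) auto
  finally show ?thesis by simp
qed

lemma Qsum_nonneg: "Qsum m \<ge> 0"
  unfolding Qsum_def using zpt_pos[of m] by (intro sum_nonneg) auto

lemma Bcoeff_diag_pos: "Bcoeff m m > 0"
  unfolding Bcoeff_diag using zpt_pos[of m] b_zpt_le_1[of m] Qsum_nonneg[of m]
  by (intro add_pos_nonneg mult_nonneg_nonneg) auto

lemma Pcoeff_diag_pos: "Pcoeff m m > 0"
  unfolding Pcoeff_diag using Bcoeff_diag_pos[of m] b_zpt_le_1[of m] by simp

lemma eig_pos: "eig m > 0"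
  unfolding eig_def using Bcoeff_diag_pos Pcoeff_diag_pos by simp

lemma eig_0: "eig 0 = 1"
  using Pcoeff_diag_pos[of 0] by (simp add: eig_def Pcoeff_diag b_zpt)

text \<open>On the diagonal \<open>Pcoeff\<close> is \<open>Bcoeff + 1 - b * zpt\<close>, so after
  multiplication by \<open>Pcoeff j j\<close> the products of two \<open>Bcoeff\<close> cancel.
  Besides monotonicity this gives the denominators in \<open>acoeff\<close> a lower bound relative
  to \<open>eig j\<close>.\<close>

lemma eig_gap:
  assumes "j < m"
  shows "eig j * Pcoeff m m - Bcoeff m m \<ge> eig j / 4"
proof (cases "j = 0")
  case True
  then show ?thesis using b_zpt_le[of m] assms by (simp add: eig_0 Pcoeff_diag)
next
  case False
  let ?G = "\<lambda>m. zpt m ^ length w + Qsum m" and ?e = "\<lambda>m. 1 - b * zpt m"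
  have e: "0 \<le> ?e i" "?e i \<le> 1" for i using b_zpt_le_1[of i] zpt_pos[of i] by auto
  have "Qsum m \<le> (\<Sum>q\<in>periods w. zpt j ^ q / 2)"
    unfolding Qsum_def using assms by (intro sum_mono zpt_power_half) (auto dest: periods_bounds)
  then have "Qsum m \<le> Qsum j / 2" by (simp add: Qsum_def sum_divide_distrib)
  moreover have "zpt m ^ length w \<le> zpt j ^ length w / 2"
    using assms w_ne by (intro zpt_power_half) auto
  ultimately have G: "?G m \<le> ?G j / 2" by simp
  have "Bcoeff m m \<le> ?G m"
    unfolding Bcoeff_diag using e[of m] Qsum_nonneg[of m] by (intro add_left_mono mult_left_le_one_le) auto
  then have "Bcoeff m m * ?e j \<le> ?G j / 2 * ?e j"
    using G e[of j] by (intro mult_right_mono) auto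
  also have "\<dots> = (?e j * zpt j ^ length w + ?e j * Qsum j) / 2" by (simp add: algebra_simps)
  also have "\<dots> \<le> Bcoeff j j / 2"
    unfolding Bcoeff_diag using e[of j] zpt_pos[of j] mult_left_le_one_le[of "zpt j ^ length w" "?e j"] by simp
  finally have 1: "Bcoeff m m * ?e j \<le> Bcoeff j j / 2" .
  \<comment> \<open>Here \<open>m \<ge> 2\<close>, since \<open>0 < j < m\<close>, so the factor is
    at least 3/4; against the 1/2 of the previous bound this leaves the quarter.\<close>
  have "Bcoeff j j * ?e m \<ge> Bcoeff j j * (3/4)"
    using b_zpt_le'[of m] False assms Bcoeff_diag_pos[of j] by (intro mult_left_mono) auto
  with 1 have "Bcoeff j j * ?e m - Bcoeff m m * ?e j \<ge> Bcoeff j j / 4" by linarith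
  then have "(Bcoeff j j * Pcoeff m m - Bcoeff m m * Pcoeff j j) / Pcoeff j j \<ge> (Bcoeff j j / 4) / Pcoeff j j"
    using Pcoeff_diag_pos[of j] by (intro divide_right_mono) (auto simp: Pcoeff_diag algebra_simps)
  then show ?thesis using Pcoeff_diag_pos[of j] by (simp add: eig_def diff_divide_distrib)
qed

lemma eig_strict: "j < m \<Longrightarrow> eig m < eig j"
proof -
  assume "j < m"
  then have "Bcoeff m m < eig j * Pcoeff m m" using eig_gap[of j m] eig_pos[of j] by linarith
  then show ?thesis using Pcoeff_diag_pos[of m] by (simp add: eig_def[of m] divide_less_eq)
qed

lemma eig_antimono: "j \<le> m \<Longrightarrow> eig m \<le> eig j"
  using eig_strict[of j m] by (cases "j = m") auto

lemma eig_tendsto_0: "eig \<longlonglongrightarrow> 0"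
proof (rule tendsto_sandwich[of "\<lambda>_. 0"])
  let ?c = "2 * (1 + real (card (periods w)))"
  have "eig m \<le> ?c * (1/2) ^ m" if "m > 0" for m
  proof -
    have "(2::real) ^ m \<le> 2 ^ Suc m" by simp
    also have "\<dots> \<le> real b ^ Suc m" using b_ge2 by (intro power_mono) auto
    finally have z: "zpt m \<le> (1/2) ^ m"
      unfolding zpt_def power_one_over by (intro divide_left_mono mult_pos_pos zero_less_power) (use b_pos in auto)
    have zq: "zpt m ^ q \<le> zpt m" if "q > 0" for q
      using power_decreasing[of 1 q "zpt m"] that zpt_pos[of m] z power_le_one[of "1/2::real" m] by simp
    have "Qsum m \<le> (\<Sum>q\<in>periods w. zpt m)"
      unfolding Qsum_def by (intro sum_mono zq) (auto dest: periods_bounds)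
    then have Q: "Qsum m \<le> card (periods w) * zpt m" by simp
    have "Bcoeff m m \<le> zpt m ^ length w + Qsum m"
      unfolding Bcoeff_diag using b_zpt_le_1[of m] zpt_pos[of m] Qsum_nonneg[of m] by (intro add_left_mono mult_left_le_one_le) auto
    also have "\<dots> \<le> (1 + card (periods w)) * zpt m"
      using Q zq[of "length w"] w_ne by (simp add: algebra_simps)
    also have "\<dots> \<le> (1 + card (periods w)) * (1/2) ^ m" using z by (intro mult_left_mono) auto
    finally have B: "Bcoeff m m \<le> (1 + card (periods w)) * (1/2) ^ m" .
    have "Pcoeff m m \<ge> 1/2"
      unfolding Pcoeff_diag using b_zpt_le[OF that] Bcoeff_diag_pos[of m] by simp
    then have "eig m \<le> Bcoeff m m / (1/2)"
      unfolding eig_def using Bcoeff_diag_pos[of m] by (intro divide_left_mono) auto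
    then show ?thesis using B by (simp add: algebra_simps)
  qed
  then show "\<forall>\<^sub>F m in sequentially. eig m \<le> ?c * (1/2) ^ m"
    by (intro eventually_sequentiallyI[of 1]) auto
  show "(\<lambda>m. ?c * (1/2) ^ m) \<longlonglongrightarrow> 0"
    by (intro tendsto_mult_right_zero LIMSEQ_power_zero) auto
qed (auto intro!: always_eventually less_imp_le eig_pos)

text \<open>For \<open>j < m\<close> the recurrence of the moments forces the coefficient of \<open>eig j ^ k\<close>; the
  remaining one is fixed by the initial value.\<close>
function acoeff :: "nat \<Rightarrow> nat \<Rightarrow> real" where
  "acoeff m j = (if j < m then (\<Sum>l\<in>{j..<m}. (Bcoeff m l - eig j * Pcoeff m l) * acoeff l j) / (eig j * Pcoeff m m - Bcoeff m m)
     else if j = m then mom 1 m - (\<Sum>i\<in>{..<m}. acoeff m i) else 0)"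
  by auto
termination
  by (relation "measures [fst, snd]") auto

declare acoeff.simps [simp del]

lemma acoeff_less:
  assumes "j < m"
  shows "(eig j * Pcoeff m m - Bcoeff m m) * acoeff m j = (\<Sum>l\<in>{j..<m}. (Bcoeff m l - eig j * Pcoeff m l) * acoeff l j)"
  using eig_gap[OF assms] eig_pos[of j] assms by (subst acoeff.simps) auto

lemma acoeff_sum: "(\<Sum>j\<le>m. acoeff m j) = mom 1 m"
  unfolding lessThan_Suc_atMost[symmetric] by (simp add: acoeff.simps[of m m])

text \<open>Induction on the degree, and inside it on \<open>k\<close>: the lower moments are
  already combinations of powers of eigenvalues, and the triangular recurrence carries the expansion
  from \<open>k\<close> to \<open>k + 1\<close>.\<close>

lemma mom_expansion: "mom (Suc k) m = (\<Sum>j\<le>m. acoeff m j * eig j ^ k)"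
proof (induction m arbitrary: k rule: less_induct)
  case (less m)
  show ?case
  proof (induction k)
    case 0
    then show ?case by (simp add: acoeff_sum)
  next
    case (Suc k)
    have split: "(\<Sum>l\<le>m. F l) = F m + (\<Sum>l<m. F l)" for F :: "nat \<Rightarrow> real"
      unfolding lessThan_Suc_atMost[symmetric] by simp
    have B: "Bcoeff m m = eig m * Pcoeff m m" using Pcoeff_diag_pos[of m] by (simp add: eig_def)
    \<comment> \<open>The recurrence is used only from index \<open>Suc k\<close> on, where the
      inhomogeneous term is gone.\<close>
    have "Pcoeff m m * mom (Suc (Suc k)) m = Bcoeff m m * mom (Suc k) m
        + (\<Sum>l<m. Bcoeff m l * mom (Suc k) l - Pcoeff m l * mom (Suc (Suc k)) l)"
      using mom_recurrence[of m "Suc k"] by (simp add: split sum_subtractf)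
    also have "(\<Sum>l<m. Bcoeff m l * mom (Suc k) l - Pcoeff m l * mom (Suc (Suc k)) l)
      = (\<Sum>l<m. \<Sum>j\<le>l. (Bcoeff m l - eig j * Pcoeff m l) * acoeff l j * eig j ^ k)"
      using less by (intro sum.cong refl) (simp add: sum_distrib_left algebra_simps flip: sum_subtractf)
    also have "\<dots> = (\<Sum>j<m. \<Sum>l\<in>{j..<m}. (Bcoeff m l - eig j * Pcoeff m l) * acoeff l j * eig j ^ k)"
      unfolding sum.Sigma[OF finite_lessThan ballI[OF finite_atMost]] sum.Sigma[OF finite_lessThan ballI[OF finite_atLeastLessThan]]
      by (rule sum.reindex_bij_witness[of _ "\<lambda>(x, y). (y, x)" "\<lambda>(x, y). (y, x)"]) auto
    also have "\<dots> = (\<Sum>j<m. (eig j * Pcoeff m m - Bcoeff m m) * acoeff m j * eig j ^ k)"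
      by (intro sum.cong refl) (simp add: acoeff_less sum_distrib_right)
    \<comment> \<open>For \<open>j < m\<close> the factors \<open>Bcoeff m m\<close> and
      \<open>eig j * Pcoeff m m - Bcoeff m m\<close> add up to \<open>eig j * Pcoeff m m\<close>,
      which raises the power of \<open>eig j\<close> by one.\<close>
    also have "Bcoeff m m * mom (Suc k) m = Bcoeff m m * acoeff m m * eig m ^ k + (\<Sum>j<m. Bcoeff m m * acoeff m j * eig j ^ k)"
      by (simp add: Suc split sum_distrib_left distrib_left mult.assoc)
    also have "\<dots> + (\<Sum>j<m. (eig j * Pcoeff m m - Bcoeff m m) * acoeff m j * eig j ^ k)
      = Bcoeff m m * acoeff m m * eig m ^ k + (\<Sum>j<m. Pcoeff m m * (acoeff m j * eig j ^ Suc k))"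
      unfolding add.assoc sum.distrib[symmetric]
      by (intro arg_cong2[of _ _ _ _ "(+)"] sum.cong refl) (simp add: algebra_simps)
    also have "\<dots> = Pcoeff m m * (\<Sum>j\<le>m. acoeff m j * eig j ^ Suc k)"
      by (simp add: split sum_distrib_left distrib_left B mult_ac)
    finally show ?case using Pcoeff_diag_pos[of m] by simp
  qed
qed

end

section \<open>Growth of the moment coefficients\<close>

text \<open>With \<open>M * r ^ l\<close> inserted for \<open>N l\<close>, the binomial theorem
  bounds the sum by \<open>M * (\<theta> + \<beta> * r) ^ m\<close>, which is exponentially smaller
  than \<open>M * r ^ m\<close>; from some \<open>m0\<close> on, \<open>K\<close> times it is at
  most half of \<open>M * r ^ m\<close>.\<close>

lemma binomial_recursion_growth:
  fixes N :: "nat \<Rightarrow> real"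
  assumes nonneg: "\<And>m. N m \<ge> 0" "C \<ge> 0" "K \<ge> 0" "\<theta> \<ge> 0" "\<beta> \<ge> 0"
    and r: "r \<ge> 1" "\<theta> + \<beta> * r < r"
    and rec: "\<And>m. N m \<le> C + K * (\<Sum>l<m. real (m choose l) * \<theta> ^ (m - l) * \<beta> ^ l * N l)"
  obtains M where "M \<ge> 0" "\<And>m. N m \<le> M * r ^ m"
proof -
  let ?s = "(\<theta> + \<beta> * r) / r"
  have s: "0 \<le> ?s" "?s < 1" using assms by auto
  have "(\<lambda>m. K * ?s ^ m) \<longlonglongrightarrow> 0" using s by (intro tendsto_mult_right_zero LIMSEQ_power_zero) auto
  then have "\<forall>\<^sub>F m in sequentially. K * ?s ^ m < 1/2" by (rule order_tendstoD) simp
  then obtain m0 where m0: "\<And>m. m \<ge> m0 \<Longrightarrow> K * ?s ^ m < 1/2"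
    by (auto simp: eventually_sequentially)
  \<comment> \<open>The sum covers the finitely many values before \<open>m0\<close>; the term
    \<open>2 * C\<close> lets the remaining half of \<open>M * r ^ m\<close> absorb
    \<open>C\<close>.\<close>
  define M where "M = 2 * C + (\<Sum>i<m0. N i)"
  have M: "M \<ge> 2 * C" "M \<ge> 0" unfolding M_def using nonneg sum_nonneg[of "{..<m0}" N] by auto
  have rm: "r ^ m \<ge> 1" for m using r(1) by simp
  have "N m \<le> M * r ^ m" for m
  proof (induction m rule: less_induct)
    case (less m)
    show ?case
    proof (cases "m < m0")
      case True
      then have "N m \<le> (\<Sum>i<m0. N i)" using nonneg by (intro member_le_sum) auto
      then have "N m \<le> M" unfolding M_def using nonneg by simp
      also have "\<dots> \<le> M * r ^ m" using M rm[of m] mult_left_mono[of 1 "r ^ m" M] by simp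
      finally show ?thesis .
    next
      case False
      have "(\<Sum>l<m. real (m choose l) * \<theta> ^ (m - l) * \<beta> ^ l * N l)
        \<le> (\<Sum>l<m. real (m choose l) * \<theta> ^ (m - l) * \<beta> ^ l * (M * r ^ l))"
        using less nonneg by (intro sum_mono mult_left_mono) auto
      also have "\<dots> \<le> (\<Sum>l\<le>m. real (m choose l) * \<theta> ^ (m - l) * \<beta> ^ l * (M * r ^ l))"
        using M nonneg r by (intro sum_mono2) auto
      also have "\<dots> = M * (\<beta> * r + \<theta>) ^ m"
        unfolding binomial_ring sum_distrib_left by (intro sum.cong refl) (simp add: power_mult_distrib mult_ac)
      also have "(\<beta> * r + \<theta>) ^ m = ?s ^ m * r ^ m" using r by (simp add: power_divide add.commute)
      finally have "N m \<le> C + K * (M * (?s ^ m * r ^ m))"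
        using rec[of m] mult_left_mono[OF _ nonneg(3)] by (meson add_left_mono order_trans)
      also have "\<dots> = C + (K * ?s ^ m) * (M * r ^ m)" by (simp only: mult_ac)
      also have "\<dots> \<le> C + 1/2 * (M * r ^ m)"
        using m0[of m] False M r by (intro add_left_mono mult_right_mono) auto
      also have "C \<le> 1/2 * (M * r ^ m)"
        using M rm[of m] mult_left_mono[of 1 "r ^ m" M] by simp
      finally show ?thesis by simp
    qed
  qed
  with M that show ?thesis by blast
qed

text \<open>Fubini for an absolutely summable array with finite rows. It serves to regroup a series
  of finite eigenvalue expansions by eigenvalue.\<close>

lemma triangular_series_swap:
  fixes x :: "nat \<Rightarrow> nat \<Rightarrow> real"
  assumes tri: "\<And>m j. j > m \<Longrightarrow> x m j = 0" and summ: "summable (\<lambda>m. \<Sum>j\<le>m. \<bar>x m j\<bar>)"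
  shows "summable (\<lambda>j. \<bar>\<Sum>m. x m j\<bar>)" "(\<Sum>j. \<Sum>m. x m j) = (\<Sum>m. \<Sum>j\<le>m. x m j)"
proof -
  have abs: "(\<lambda>(m, j). \<bar>x m j\<bar>) summable_on UNIV \<times> UNIV"
  proof (rule nonneg_bdd_above_summable_on)
    show "bdd_above (sum (\<lambda>(m, j). \<bar>x m j\<bar>) ` {F. F \<subseteq> UNIV \<times> UNIV \<and> finite F})"
    proof (rule bdd_aboveI2)
      fix F :: "(nat \<times> nat) set" assume "F \<in> {F. F \<subseteq> UNIV \<times> UNIV \<and> finite F}"
      then have "finite F" by simp
      define N where "N = Suc (Max (insert 0 (fst ` F)))"
      define N' where "N' = Suc (Max (insert 0 (snd ` F)))"
      have "fst p < N \<and> snd p < N'" if "p \<in> F" for p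
        unfolding N_def N'_def less_Suc_eq_le using that \<open>finite F\<close> by (auto intro!: Max_ge)
      then have "F \<subseteq> {..<N} \<times> {..<N'}" by fastforce
      then have "sum (\<lambda>(m, j). \<bar>x m j\<bar>) F \<le> sum (\<lambda>(m, j). \<bar>x m j\<bar>) ({..<N} \<times> {..<N'})"
        by (intro sum_mono2) auto
      also have "\<dots> = (\<Sum>m<N. \<Sum>j<N'. \<bar>x m j\<bar>)" by (simp add: sum.cartesian_product)
      also have "\<dots> \<le> (\<Sum>m<N. \<Sum>j\<le>m. \<bar>x m j\<bar>)"
      proof (rule sum_mono)
        fix m
        have "(\<Sum>j<N'. \<bar>x m j\<bar>) = (\<Sum>j\<in>{..<N'} \<inter> {..m}. \<bar>x m j\<bar>)"
          using tri[of m] by (intro sum.mono_neutral_right) (auto simp: not_le)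
        also have "\<dots> \<le> (\<Sum>j\<le>m. \<bar>x m j\<bar>)" by (intro sum_mono2) auto
        finally show "(\<Sum>j<N'. \<bar>x m j\<bar>) \<le> (\<Sum>j\<le>m. \<bar>x m j\<bar>)" .
      qed
      also have "\<dots> \<le> (\<Sum>m. \<Sum>j\<le>m. \<bar>x m j\<bar>)"
        by (intro sum_le_suminf summ) (auto intro: sum_nonneg)
      finally show "sum (\<lambda>(m, j). \<bar>x m j\<bar>) F \<le> (\<Sum>m. \<Sum>j\<le>m. \<bar>x m j\<bar>)" .
    qed
  qed auto
  have abs': "(\<lambda>(j, m). \<bar>x m j\<bar>) summable_on UNIV \<times> UNIV"
    using summable_on_swap[of "\<lambda>(m, j). \<bar>x m j\<bar>" UNIV UNIV] abs by (simp add: case_prod_unfold prod.swap_def)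
  have xs: "(\<lambda>(m, j). x m j) summable_on UNIV \<times> UNIV"
    by (rule abs_summable_summable) (use abs in \<open>simp add: case_prod_unfold\<close>)
  have xs': "(\<lambda>(j, m). x m j) summable_on UNIV \<times> UNIV"
    by (rule abs_summable_summable) (use abs' in \<open>simp add: case_prod_unfold\<close>)
  have inf_sum: "infsum f UNIV = suminf f" if "f summable_on UNIV" for f :: "nat \<Rightarrow> real"
    using has_sum_imp_sums[OF has_sum_infsum[OF that]] by (simp add: sums_iff)
  have col: "(\<lambda>m. x m j) summable_on UNIV" for j
    using summable_on_SigmaD1[of "\<lambda>j m. x m j" UNIV "\<lambda>_. UNIV" j] xs' by simp
  have col_abs: "(\<lambda>m. \<bar>x m j\<bar>) summable_on UNIV" for j
    using summable_on_SigmaD1[of "\<lambda>j m. \<bar>x m j\<bar>" UNIV "\<lambda>_. UNIV" j] abs' by simp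
  have row: "(\<lambda>j. x m j) summable_on UNIV" for m
    using summable_on_SigmaD1[of "\<lambda>m j. x m j" UNIV "\<lambda>_. UNIV" m] xs by simp
  have cols: "(\<lambda>j. \<Sum>\<^sub>\<infinity>m. x m j) summable_on UNIV"
    using summable_on_Sigma_banach[of "\<lambda>j m. x m j" UNIV "\<lambda>_. UNIV"] xs' by simp
  have cols_abs: "(\<lambda>j. \<Sum>\<^sub>\<infinity>m. \<bar>x m j\<bar>) summable_on UNIV"
    using summable_on_Sigma_banach[of "\<lambda>j m. \<bar>x m j\<bar>" UNIV "\<lambda>_. UNIV"] abs' by simp
  have rows: "(\<lambda>m. \<Sum>\<^sub>\<infinity>j. x m j) summable_on UNIV"
    using summable_on_Sigma_banach[of "\<lambda>m j. x m j" UNIV "\<lambda>_. UNIV"] xs by simp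
  have row_fin: "(\<Sum>\<^sub>\<infinity>j. x m j) = (\<Sum>j\<le>m. x m j)" for m
  proof -
    have "(\<Sum>\<^sub>\<infinity>j. x m j) = (\<Sum>\<^sub>\<infinity>j\<in>{..m}. x m j)"
      using tri[of m] by (intro infsum_cong_neutral) (auto simp: not_le)
    then show ?thesis by simp
  qed
  have "(\<Sum>j. \<Sum>m. x m j) = (\<Sum>\<^sub>\<infinity>j. \<Sum>\<^sub>\<infinity>m. x m j)"
    using inf_sum[OF cols] by (simp add: inf_sum[OF col])
  also have "\<dots> = (\<Sum>\<^sub>\<infinity>m. \<Sum>\<^sub>\<infinity>j. x m j)"
    using infsum_swap_banach[of "\<lambda>j m. x m j" UNIV UNIV] xs' by simp
  also have "\<dots> = (\<Sum>m. \<Sum>j\<le>m. x m j)"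
    using inf_sum[OF rows] by (simp add: row_fin)
  finally show "(\<Sum>j. \<Sum>m. x m j) = (\<Sum>m. \<Sum>j\<le>m. x m j)" .
  have "summable (\<lambda>j. \<Sum>\<^sub>\<infinity>m. \<bar>x m j\<bar>)"
    by (rule summable_on_imp_summable[OF cols_abs])
  moreover have "\<bar>\<Sum>m. x m j\<bar> \<le> (\<Sum>\<^sub>\<infinity>m. \<bar>x m j\<bar>)" for j
    using norm_infsum_bound[of "\<lambda>m. x m j" UNIV] col_abs[of j]
    unfolding real_norm_def inf_sum[OF col] by blast
  ultimately show "summable (\<lambda>j. \<bar>\<Sum>m. x m j\<bar>)"
    using summable_comparison_test'[of "\<lambda>j. \<Sum>\<^sub>\<infinity>m. \<bar>x m j\<bar>" 0 "\<lambda>j. \<bar>\<Sum>m. x m j\<bar>"] by simp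
qed

context block
begin

definition theta :: real where
  "theta = 1 - 1 / real b ^ length w"

text \<open>Midpoint of \<open>theta * b / (b - 1)\<close> and \<open>b / (b - 1)\<close>: above the
  first the recursion for the coefficients contracts, below the second the decay of the Taylor
  coefficients of reciprocals wins.\<close>

definition rad :: real where
  "rad = real b / (real b - 1) * ((1 + theta) / 2)"

lemma theta_bounds: "0 \<le> theta" "theta < 1"
  using b_ge2 by (auto simp: theta_def)

lemma rad_less: "rad < real b / (real b - 1)"
proof -
  have "real b / (real b - 1) * ((1 + theta) / 2) < real b / (real b - 1) * 1"
    using theta_bounds b_ge2 by (intro mult_strict_left_mono) auto
  then show ?thesis by (simp add: rad_def)
qed

lemma rad_ge_1: "rad \<ge> 1"
proof -
  have "real b ^ 1 \<le> real b ^ length w" using b_ge2 w_ne by (intro power_increasing) (auto simp: Suc_le_eq)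
  then have "1 / real b ^ length w \<le> 1 / real b" using b_ge2 by (intro divide_left_mono) auto
  then have "(1 + theta) / 2 \<ge> 1 - 1 / (2 * b)" by (simp add: theta_def)
  then have "rad \<ge> real b / (real b - 1) * (1 - 1 / (2 * b))"
    unfolding rad_def using b_ge2 by (intro mult_left_mono) auto
  moreover have "real b / (real b - 1) * (1 - 1 / (2 * b)) \<ge> 1"
    using b_ge2 by (simp add: field_simps)
  ultimately show ?thesis by simp
qed

lemma rad_contract: "theta + 1 / b * rad < rad"
proof -
  have "real b / (real b - 1) * (1 - 1 / b) = 1" using b_ge2 by (simp add: field_simps)
  moreover have "rad - 1 / b * rad = (real b / (real b - 1) * (1 - 1 / b)) * ((1 + theta) / 2)"
    by (simp only: rad_def mult_ac right_diff_distrib left_diff_distrib mult_1_left mult_1_right)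
  ultimately have *: "rad - 1 / b * rad = (1 + theta) / 2" by (simp only: mult_1_left)
  have "theta < (1 + theta) / 2" using theta_bounds by simp
  then show ?thesis unfolding *[symmetric] less_diff_eq .
qed

lemma min_period_mem: "min_period \<in> insert (length w) (periods w)"
  unfolding min_period_def by (intro Min_in) auto

lemma min_period_bounds: "0 < min_period" "min_period \<le> length w"
  using min_period_mem w_ne by (auto dest: periods_bounds)

lemma min_period_le: "q \<in> insert (length w) (periods w) \<Longrightarrow> min_period \<le> q"
  unfolding min_period_def by (intro Min_le) auto

lemma power_min_period_gt_1: "real b ^ min_period > 1"
  using b_ge2 min_period_bounds(1) by (intro one_less_power) auto

lemma nval_le: "set v \<subseteq> {..<b} \<Longrightarrow> real (nval b v) \<le> real b ^ length v - 1"
proof -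
  assume "set v \<subseteq> {..<b}"
  then have "real (nval b v + 1) \<le> real (b ^ length v)"
    using nval_less by (simp only: of_nat_le_iff) (simp add: Suc_le_eq)
  then show ?thesis by simp
qed

lemma center_bounds: "0 \<le> center" "center \<le> 1"
  using nval_le[OF tail_digits[of min_period]] length_tail[OF min_period_bounds(2)] power_min_period_gt_1
  by (auto simp: center_def divide_le_eq_1)

text \<open>The reason for the choice of \<open>center\<close>: the matrix of the operator of the
  shortest suffix becomes diagonal.\<close>

lemma shift_tail_min_period: "shift (tail min_period) = 0"
proof -
  let ?B = "real b ^ min_period" and ?n = "real (nval b (tail min_period))"
  have "?n + center = ?B * center"
    using power_min_period_gt_1 by (simp add: center_def field_simps)
  then show ?thesis
    using b_pos unfolding shift_def length_tail[OF min_period_bounds(2)] by simp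
qed

lemma shift_le:
  assumes "set v \<subseteq> {..<b}" "length v \<le> length w"
  shows "\<bar>shift v\<bar> \<le> theta"
proof -
  let ?B = "real b ^ length v"
  have B: "?B \<ge> 1" using b_pos by (simp add: one_le_power)
  have "(?B - 1) * center \<le> ?B - 1" "0 \<le> (?B - 1) * center"
    using center_bounds B by (auto intro: mult_left_le)
  moreover have "0 \<le> real (nval b v)" "real (nval b v) \<le> ?B - 1" using nval_le[OF assms(1)] by auto
  ultimately have *: "\<bar>real (nval b v) - (?B - 1) * center\<bar> \<le> ?B - 1" by linarith
  have "shift v = (real (nval b v) - (?B - 1) * center) / ?B"
    using b_pos by (simp add: shift_def field_simps)
  then have "\<bar>shift v\<bar> \<le> (?B - 1) / ?B"
    using * B by (simp add: abs_divide divide_right_mono)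
  also have "\<dots> = 1 - 1 / ?B" using b_pos by (simp add: field_simps)
  also have "\<dots> \<le> theta"
    unfolding theta_def using assms(2) b_ge2 by (simp add: divide_left_mono power_increasing)
  finally show ?thesis .
qed

lemma zpt_le_1: "zpt m \<le> 1"
  using b_pos one_le_power[of "real b" "Suc m"] by (simp add: zpt_def divide_le_eq_1)

lemma op_coeff_le:
  assumes "set v \<subseteq> {..<b}" "length v \<le> length w" "s \<le> length v"
  shows "\<bar>op_coeff v m l\<bar> \<le> real (m choose l) * theta ^ (m - l) * zpt l ^ s"
proof -
  have "zpt l ^ length v \<le> zpt l ^ s"
    using zpt_pos[of l] zpt_le_1[of l] assms(3) by (intro power_decreasing) auto
  moreover have "\<bar>shift v\<bar> ^ (m - l) \<le> theta ^ (m - l)"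
    using shift_le[OF assms(1,2)] by (intro power_mono) auto
  ultimately show ?thesis
    unfolding op_coeff_def abs_mult power_abs using zpt_pos[of l] theta_bounds
    by (intro mult_mono) auto
qed

text \<open>The least period contributes nothing for \<open>l < m\<close>, and every other suffix
  has at least \<open>min_period + 1\<close> letters. The extra factor \<open>zpt l\<close> gained
  this way is decisive in \<open>coeff_bound\<close>.\<close>

lemma op_coeff_tail_le:
  assumes "q \<in> insert (length w) (periods w)" "l < m"
  shows "\<bar>op_coeff (tail q) m l\<bar> \<le> real (m choose l) * theta ^ (m - l) * zpt l ^ Suc min_period"
proof (cases "q = min_period")
  case True
  then have "op_coeff (tail q) m l = 0" using assms by (simp add: op_coeff_def shift_tail_min_period)
  then show ?thesis using theta_bounds zpt_pos[of l] by simp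
next
  case False
  have "q \<le> length w" using assms by (auto dest: periods_bounds)
  then show ?thesis using False min_period_le[OF assms(1)] by (intro op_coeff_le tail_digits) (auto simp: length_tail)
qed

lemma tail_length: "tail (length w) = w" by (simp add: tail_def)

lemma Bcoeff_le:
  assumes "l < m"
  shows "\<bar>Bcoeff m l\<bar> \<le> (1 + card (periods w) * (1 + b)) * (real (m choose l) * theta ^ (m - l) * zpt l ^ Suc min_period)"
proof -
  let ?T = "real (m choose l) * theta ^ (m - l) * zpt l ^ Suc min_period"
  have 1: "\<bar>op_coeff (d # tail q) m l\<bar> \<le> ?T" if "q \<in> periods w" "d < b" for q d
    using that min_period_le[of q] tail_digits[of q] periods_bounds[of q]
    by (intro op_coeff_le) (auto simp: length_tail)
  have "\<bar>op_coeff (tail q) m l - (\<Sum>d<b. op_coeff (d # tail q) m l)\<bar> \<le> (1 + b) * ?T" if q: "q \<in> periods w" for q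
  proof -
    have "\<bar>\<Sum>d<b. op_coeff (d # tail q) m l\<bar> \<le> (\<Sum>d<b. ?T)"
      using 1[OF q] by (intro order.trans[OF sum_abs sum_mono]) blast
    then have "\<bar>\<Sum>d<b. op_coeff (d # tail q) m l\<bar> \<le> b * ?T" by simp
    moreover have "\<bar>op_coeff (tail q) m l\<bar> \<le> ?T" using q assms by (intro op_coeff_tail_le) auto
    ultimately have "\<bar>op_coeff (tail q) m l - (\<Sum>d<b. op_coeff (d # tail q) m l)\<bar> \<le> ?T + b * ?T"
      by (intro order.trans[OF abs_triangle_ineq4]) linarith
    then show ?thesis by (simp add: algebra_simps)
  qed
  then have "\<bar>\<Sum>q\<in>periods w. op_coeff (tail q) m l - (\<Sum>d<b. op_coeff (d # tail q) m l)\<bar> \<le> (\<Sum>q\<in>periods w. (1 + b) * ?T)"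
    by (intro order.trans[OF sum_abs sum_mono])
  moreover have "\<bar>op_coeff w m l\<bar> \<le> ?T" using op_coeff_tail_le[of "length w" l m] assms by (simp add: tail_length)
  ultimately have "\<bar>Bcoeff m l\<bar> \<le> ?T + (\<Sum>q\<in>periods w. (1 + b) * ?T)"
    unfolding Bcoeff_def by (intro order.trans[OF abs_triangle_ineq add_mono])
  then show ?thesis by (simp add: algebra_simps)
qed

lemma Acoeff_le: "\<bar>Acoeff m l\<bar> \<le> b * (real (m choose l) * theta ^ (m - l) * zpt l)"
proof -
  have "\<bar>op_coeff [d] m l\<bar> \<le> real (m choose l) * theta ^ (m - l) * zpt l" if "d < b" for d
    using op_coeff_le[of "[d]" 1 m l] that w_ne by (auto simp: Suc_le_eq)
  then have "\<bar>Acoeff m l\<bar> \<le> (\<Sum>d<b. real (m choose l) * theta ^ (m - l) * zpt l)"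
    unfolding Acoeff_def by (intro order.trans[OF sum_abs sum_mono]) auto
  then show ?thesis by simp
qed

text \<open>The least period alone keeps \<open>Bcoeff l l\<close> of order
  \<open>zpt l ^ min_period\<close>; this limits the loss from dividing by
  \<open>eig l\<close>.\<close>

lemma eig_lower:
  "eig l \<ge> 1 / real b ^ length w / (2 + card (periods w)) * zpt l ^ min_period"
proof -
  let ?k = "1 / real b ^ length w"
  have "real b ^ 1 \<le> real b ^ length w" using b_ge2 w_ne by (intro power_increasing) (auto simp: Suc_le_eq)
  then have bw: "2 \<le> real b ^ length w" using b_ge2 unfolding power_one_right by linarith
  then have k: "0 < ?k" "?k \<le> 1/2" "?k \<le> 1" using b_pos by (auto simp: divide_simps)
  have zq: "zpt l ^ q \<le> 1" "zpt l ^ q > 0" for q using zpt_pos[of l] zpt_le_1[of l] by (auto simp: power_le_one)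
  have B: "Bcoeff l l \<ge> ?k * zpt l ^ min_period"
  proof (cases "l = 0")
    \<comment> \<open>For \<open>l = 0\<close> the factor \<open>1 - b * zpt l\<close> kills the
      period terms and only \<open>zpt 0 ^ length w\<close> remains, which dictates the constant
      \<open>1 / b ^ length w\<close>.\<close>
    case True
    then have "Bcoeff l l = ?k" using b_zpt[of 0] by (simp add: Bcoeff_diag) (simp add: zpt_def power_one_over)
    then show ?thesis using zq(1)[of min_period] mult_left_mono[of "zpt l ^ min_period" 1 ?k] k by simp
  next
    case False
    then have e: "1 - b * zpt l \<ge> 1/2" using b_zpt_le[of l] by simp
    show ?thesis
    proof (cases "min_period = length w")
      case True
      have "?k * zpt l ^ min_period \<le> zpt l ^ length w"
        unfolding True using k zq(2)[of "length w"] mult_right_mono[of ?k 1 "zpt l ^ length w"] by simp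
      also have "\<dots> \<le> Bcoeff l l" unfolding Bcoeff_diag using e Qsum_nonneg[of l] by simp
      finally show ?thesis .
    next
      case False
      then have "zpt l ^ min_period \<le> Qsum l"
        unfolding Qsum_def using min_period_mem zpt_pos[of l] by (intro member_le_sum) auto
      then have "?k * zpt l ^ min_period \<le> (1 - b * zpt l) * Qsum l"
        using e zq(2)[of min_period] by (intro mult_mono order.trans[OF k(2) e]) auto
      also have "\<dots> \<le> Bcoeff l l" unfolding Bcoeff_diag using zq(2)[of "length w"] by simp
      finally show ?thesis .
    qed
  qed
  have "Qsum l \<le> (\<Sum>q\<in>periods w. 1)" unfolding Qsum_def using zq by (intro sum_mono) auto
  moreover have "(1 - b * zpt l) * Qsum l \<le> Qsum l"
    using b_zpt_le_1[of l] zpt_pos[of l] Qsum_nonneg[of l] by (intro mult_left_le_one_le) auto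
  moreover have "0 \<le> b * zpt l" using zpt_pos[of l] by simp
  ultimately have P: "Pcoeff l l \<le> 2 + card (periods w)"
    unfolding Pcoeff_diag Bcoeff_diag using zq(1)[of "length w"] by simp
  have "?k * zpt l ^ min_period / (2 + card (periods w)) \<le> Bcoeff l l / Pcoeff l l"
    using B P Pcoeff_diag_pos[of l] Bcoeff_diag_pos[of l] by (intro frac_le) auto
  then show ?thesis by (simp add: eig_def)
qed

text \<open>Division by \<open>eig l\<close> costs \<open>zpt l ^ min_period\<close>, while the
  off-diagonal entries of \<open>B\<close> carry \<open>zpt l ^ Suc min_period\<close>. What is left
  is \<open>zpt l \<le> (1 / b) ^ l\<close>, the same order as for \<open>A\<close>.\<close>

lemma coeff_bound:
  obtains K where "K \<ge> 0" "\<And>m l. l < m \<Longrightarrow>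
    \<bar>Bcoeff m l\<bar> / eig l + \<bar>Pcoeff m l\<bar> \<le> K * (real (m choose l) * theta ^ (m - l) * (1 / b) ^ l)"
proof -
  define K1 where "K1 = (1 + real (card (periods w)) * (1 + b))"
  define \<kappa> where "\<kappa> = 1 / real b ^ length w / (2 + card (periods w))"
  have pos: "K1 \<ge> 0" "\<kappa> > 0" using b_pos by (auto simp: K1_def \<kappa>_def)
  show ?thesis
  proof (rule that[of "2 * (K1 / \<kappa>) + b"])
    show "2 * (K1 / \<kappa>) + b \<ge> 0" using pos by simp
    fix m l :: nat assume lm: "l < m"
    let ?T = "real (m choose l) * theta ^ (m - l)"
    have T: "?T \<ge> 0" using theta_bounds by simp
    have "\<bar>Bcoeff m l\<bar> / eig l \<le> K1 * (?T * zpt l ^ Suc min_period) / (\<kappa> * zpt l ^ min_period)"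
    proof (rule frac_le)
      show "0 \<le> K1 * (?T * zpt l ^ Suc min_period)" using pos T zpt_pos[of l] by simp
      show "\<bar>Bcoeff m l\<bar> \<le> K1 * (?T * zpt l ^ Suc min_period)"
        using Bcoeff_le[OF lm] by (simp only: K1_def of_nat_add of_nat_mult of_nat_1)
      show "0 < \<kappa> * zpt l ^ min_period" using pos zpt_pos[of l] by simp
      show "\<kappa> * zpt l ^ min_period \<le> eig l" using eig_lower[of l] by (simp only: \<kappa>_def of_nat_add of_nat_numeral)
    qed
    also have "\<dots> = K1 / \<kappa> * (?T * zpt l)" using zpt_pos[of l] pos by simp
    finally have B: "\<bar>Bcoeff m l\<bar> / eig l \<le> K1 / \<kappa> * (?T * zpt l)" .
    have "\<bar>Bcoeff m l\<bar> * eig l \<le> \<bar>Bcoeff m l\<bar> * 1"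
      using eig_antimono[of 0 l] eig_0 by (intro mult_left_mono) auto
    then have "\<bar>Bcoeff m l\<bar> \<le> \<bar>Bcoeff m l\<bar> / eig l" using eig_pos[of l] by (simp add: le_divide_eq)
    moreover have "\<bar>Pcoeff m l\<bar> \<le> \<bar>Acoeff m l\<bar> + \<bar>Bcoeff m l\<bar>" using lm by (simp add: Pcoeff_def)
    ultimately have "\<bar>Bcoeff m l\<bar> / eig l + \<bar>Pcoeff m l\<bar> \<le> 2 * (K1 / \<kappa> * (?T * zpt l)) + b * (?T * zpt l)"
      using B Acoeff_le[of m l] by linarith
    also have "\<dots> = (2 * (K1 / \<kappa>) + b) * (?T * zpt l)" by (simp only: distrib_right mult.assoc)
    also have "\<dots> \<le> (2 * (K1 / \<kappa>) + b) * (?T * (1 / b) ^ l)"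
    proof (intro mult_left_mono)
      show "zpt l \<le> (1 / b) ^ l"
        using b_zpt[of l] zpt_pos[of l] b_ge2 mult_right_mono[of 1 b "zpt l"] by simp
    qed (use pos T in auto)
    finally show "\<bar>Bcoeff m l\<bar> / eig l + \<bar>Pcoeff m l\<bar> \<le> (2 * (K1 / \<kappa>) + b) * (?T * (1 / b) ^ l)" .
  qed
qed

lemma mom_le: "\<bar>mom k m\<bar> \<le> block_sum k (\<lambda>_. 1)"
proof -
  have "\<bar>cpow m x\<bar> \<le> 1" if "x \<in> {0..1}" for x
    using that center_bounds unfolding cpow_def power_abs by (intro power_le_one) auto
  then show ?thesis using wsum_bound[OF finite_mass_block, of "cpow m" 1 k] by (simp add: mom_def block_sum_def)
qed

lemma acoeff_growth:
  obtains M where "M \<ge> 0" "\<And>m. (\<Sum>j\<le>m. \<bar>acoeff m j\<bar>) \<le> M * rad ^ m"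
proof -
  obtain K where K: "K \<ge> 0" "\<And>m l. l < m \<Longrightarrow>
    \<bar>Bcoeff m l\<bar> / eig l + \<bar>Pcoeff m l\<bar> \<le> K * (real (m choose l) * theta ^ (m - l) * (1 / b) ^ l)"
    using coeff_bound by blast
  let ?N = "\<lambda>m. \<Sum>j\<le>m. \<bar>acoeff m j\<bar>" and ?C = "block_sum 1 (\<lambda>_. 1)"
  \<comment> \<open>The 8 combines the factor 4 from \<open>eig_gap\<close> with a factor 2: the
    diagonal coefficient \<open>acoeff m m\<close> is \<open>mom 1 m\<close> minus the other
    coefficients, so their sum is counted twice.\<close>
  have rec: "?N m \<le> ?C + (8 * K) * (\<Sum>l<m. real (m choose l) * theta ^ (m - l) * (1 / b) ^ l * ?N l)" for m
  proof -
    let ?F = "\<lambda>l j. 4 * (\<bar>Bcoeff m l\<bar> / eig l + \<bar>Pcoeff m l\<bar>) * \<bar>acoeff l j\<bar>"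
    have "\<bar>acoeff m j\<bar> \<le> (\<Sum>l\<in>{j..<m}. ?F l j)" if "j < m" for j
    proof -
      have quarter: "x / 4 * (4 * y * z) = x * y * z" for x y z :: real by simp
      have g: "eig j * Pcoeff m m - Bcoeff m m \<ge> eig j / 4" "eig j > 0" by (rule eig_gap[OF that], rule eig_pos)
      have "eig j / 4 * \<bar>acoeff m j\<bar> \<le> (eig j * Pcoeff m m - Bcoeff m m) * \<bar>acoeff m j\<bar>"
        using g by (intro mult_right_mono) auto
      also have "\<dots> = \<bar>(eig j * Pcoeff m m - Bcoeff m m) * acoeff m j\<bar>" using g by (simp add: abs_mult)
      also have "\<dots> \<le> (\<Sum>l\<in>{j..<m}. \<bar>(Bcoeff m l - eig j * Pcoeff m l) * acoeff l j\<bar>)"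
        unfolding acoeff_less[OF that] by (rule sum_abs)
      also have "\<dots> \<le> (\<Sum>l\<in>{j..<m}. eig j / 4 * ?F l j)"
      proof (rule sum_mono)
        fix l assume l: "l \<in> {j..<m}"
        have "\<bar>Bcoeff m l - eig j * Pcoeff m l\<bar> \<le> \<bar>Bcoeff m l\<bar> + eig j * \<bar>Pcoeff m l\<bar>"
          using g by (intro order.trans[OF abs_triangle_ineq4]) (simp add: abs_mult)
        \<comment> \<open>For \<open>j \<le> l\<close> the value \<open>eig j\<close> is at least
          \<open>eig l\<close>; extracting it makes the bound independent of \<open>j\<close>, and
          it cancels against the gap \<open>eig j / 4\<close>.\<close>
        also have "\<bar>Bcoeff m l\<bar> \<le> eig j * (\<bar>Bcoeff m l\<bar> / eig l)"
          using eig_antimono[of j l] l eig_pos[of l] mult_right_mono[of "eig l" "eig j" "\<bar>Bcoeff m l\<bar>"]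
          by (simp add: divide_simps mult_ac)
        finally have "\<bar>Bcoeff m l - eig j * Pcoeff m l\<bar> \<le> eig j * (\<bar>Bcoeff m l\<bar> / eig l + \<bar>Pcoeff m l\<bar>)"
          by (simp add: distrib_left)
        then have "\<bar>Bcoeff m l - eig j * Pcoeff m l\<bar> * \<bar>acoeff l j\<bar> \<le> eig j * (\<bar>Bcoeff m l\<bar> / eig l + \<bar>Pcoeff m l\<bar>) * \<bar>acoeff l j\<bar>"
          by (intro mult_right_mono) auto
        then show "\<bar>(Bcoeff m l - eig j * Pcoeff m l) * acoeff l j\<bar> \<le> eig j / 4 * ?F l j"
          unfolding quarter abs_mult .
      qed
      also have "\<dots> = eig j / 4 * (\<Sum>l\<in>{j..<m}. ?F l j)" by (simp only: sum_distrib_left)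
      finally show ?thesis by (rule mult_left_le_imp_le) (use g(2) in simp)
    qed
    then have "(\<Sum>j<m. \<bar>acoeff m j\<bar>) \<le> (\<Sum>j<m. \<Sum>l\<in>{j..<m}. ?F l j)" by (intro sum_mono) auto
    also have "\<dots> = (\<Sum>l<m. \<Sum>j\<le>l. ?F l j)"
      unfolding sum.Sigma[OF finite_lessThan ballI[OF finite_atMost]] sum.Sigma[OF finite_lessThan ballI[OF finite_atLeastLessThan]]
      by (rule sum.reindex_bij_witness[of _ "\<lambda>(x, y). (y, x)" "\<lambda>(x, y). (y, x)"]) auto
    also have "\<dots> = (\<Sum>l<m. 4 * (\<bar>Bcoeff m l\<bar> / eig l + \<bar>Pcoeff m l\<bar>) * ?N l)"
      by (simp only: sum_distrib_left)
    also have "\<dots> \<le> (\<Sum>l<m. 4 * (K * (real (m choose l) * theta ^ (m - l) * (1 / b) ^ l)) * ?N l)"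
      using K(2) by (intro sum_mono mult_right_mono mult_left_mono sum_nonneg) auto
    also have "\<dots> = 4 * K * (\<Sum>l<m. real (m choose l) * theta ^ (m - l) * (1 / b) ^ l * ?N l)"
      by (simp only: sum_distrib_left mult.assoc)
    finally have S: "(\<Sum>j<m. \<bar>acoeff m j\<bar>) \<le> 4 * K * (\<Sum>l<m. real (m choose l) * theta ^ (m - l) * (1 / b) ^ l * ?N l)" .
    have split: "(\<Sum>j\<le>m. F j) = F m + (\<Sum>j<m. F j)" for F :: "nat \<Rightarrow> real"
      unfolding lessThan_Suc_atMost[symmetric] by simp
    have "\<bar>acoeff m m\<bar> \<le> \<bar>mom 1 m\<bar> + (\<Sum>j<m. \<bar>acoeff m j\<bar>)"
      using acoeff_sum[of m] sum_abs[of "acoeff m" "{..<m}"] unfolding split by linarith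
    then have "?N m \<le> ?C + 2 * (\<Sum>j<m. \<bar>acoeff m j\<bar>)"
      using mom_le[of 1 m] by (simp add: split)
    then show ?thesis using S by simp
  qed
  have "?C \<ge> 0" using mom_le[of 1 0] by linarith
  show ?thesis
    by (rule binomial_recursion_growth[of ?N ?C "8 * K" theta "1 / b" rad, OF _ _ _ _ _ _ _ rec])
       (use \<open>?C \<ge> 0\<close> K theta_bounds rad_ge_1 rad_contract that in \<open>auto intro: sum_nonneg\<close>)
qed

end

section \<open>Expansion of reciprocals\<close>

context block
begin

text \<open>The integral of \<open>cpow m\<close> over [0,1].\<close>

definition Jint :: "nat \<Rightarrow> real" where
  "Jint m = ((1 - center) ^ Suc m - (- center) ^ Suc m) / Suc m"

text \<open>Lebesgue measure on [0,1] is invariant under \<open>A\<close>: substitution on the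
  \<open>b\<close> subintervals puts the integral of \<open>A f\<close> back together. The proof
  argues with antiderivatives \<open>F l\<close>, whose combination \<open>?G\<close> has derivative
  0.\<close>

lemma Jint_invariant: "(\<Sum>l\<le>m. Acoeff m l * Jint l) = Jint m"
proof -
  define F where "F l x = (x - center) ^ Suc l / Suc l" for l and x :: real
  have dF: "(F l has_real_derivative cpow l x) (at x)" for l x
    unfolding F_def cpow_def by (rule derivative_eq_intros refl | simp)+
  have J: "Jint l = F l 1 - F l 0" for l by (simp only: Jint_def F_def diff_divide_distrib diff_0)
  let ?G = "\<lambda>x. (\<Sum>d<b. F m ((real d + x) / b)) - (\<Sum>l\<le>m. Acoeff m l * F l x)"
  have "(?G has_real_derivative 0) (at x)" for x
  proof -
    have d: "((\<lambda>x. F m ((real d + x) / b)) has_real_derivative block_op b [d] (cpow m) x) (at x)" for d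
    proof -
      have "((\<lambda>x. (real d + x) / b) has_real_derivative 1 / b) (at x)"
        using b_pos by (auto intro!: derivative_eq_intros)
      from DERIV_chain2[OF dF this] show ?thesis by (simp add: block_op_def)
    qed
    have "(?G has_real_derivative (\<Sum>d<b. block_op b [d] (cpow m) x) - (\<Sum>l\<le>m. Acoeff m l * cpow l x)) (at x)"
      by (intro DERIV_diff DERIV_sum d DERIV_cmult dF)
    moreover have "(\<Sum>d<b. block_op b [d] (cpow m) x) = (\<Sum>l\<le>m. Acoeff m l * cpow l x)"
      unfolding block_op_cpow Acoeff_def sum_distrib_right by (rule sum.swap)
    ultimately show ?thesis by simp
  qed
  then have "?G 1 = ?G 0" by (intro DERIV_isconst_all) auto
  moreover have "(\<Sum>d<b. F m ((real d + 1) / b)) - (\<Sum>d<b. F m ((real d + 0) / b)) = F m 1 - F m 0"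
    using sum_lessThan_telescope[of "\<lambda>d. F m (real d / b)" b] b_pos by (simp add: sum_subtractf add.commute)
  ultimately have "(\<Sum>l\<le>m. Acoeff m l * F l 1) - (\<Sum>l\<le>m. Acoeff m l * F l 0) = F m 1 - F m 0" by linarith
  then show ?thesis by (simp add: J right_diff_distrib sum_subtractf)
qed

text \<open>For the eigenvalue 1 the recursion of \<open>acoeff\<close> involves only
  \<open>P - B = 1 - A\<close>, and the integrals satisfy the same recursion. The factor is the
  inverse of \<open>Pcoeff 0 0 = 1 / b ^ length w\<close>, forced by the inhomogeneous term at
  \<open>k = 0\<close>.\<close>

lemma acoeff_0: "acoeff m 0 = real b ^ length w * Jint m"
proof (induction m rule: less_induct)
  case (less m)
  have split: "(\<Sum>l\<le>m. F l) = F m + (\<Sum>l<m. F l)" for F :: "nat \<Rightarrow> real"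
    unfolding lessThan_Suc_atMost[symmetric] by simp
  show ?case
  proof (cases "m = 0")
    case True
    have z0: "b * zpt 0 = 1" using b_zpt[of 0] by simp
    have "Pcoeff 0 0 = (1 / real b) ^ length w" by (simp add: Pcoeff_diag Bcoeff_diag z0) (simp add: zpt_def)
    moreover have "Pcoeff 0 0 * mom 1 0 = 1"
      using mom_recurrence[of 0 0] by (simp add: mom_def[of 0] block_sum_0)
    moreover have "acoeff 0 0 = mom 1 0" using acoeff_sum[of 0] by simp
    ultimately have "Pcoeff 0 0 * acoeff 0 0 = Pcoeff 0 0 * real b ^ length w"
      using b_pos by (simp add: power_one_over)
    then show ?thesis using True Pcoeff_diag_pos[of 0] by (simp add: Jint_def)
  next
    case False
    have "(Pcoeff m m - Bcoeff m m) * acoeff m 0 = (\<Sum>l\<in>{0..<m}. (Bcoeff m l - Pcoeff m l) * acoeff l 0)"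
      using acoeff_less[of 0 m] False by (simp add: eig_0)
    also have "\<dots> = (\<Sum>l<m. Acoeff m l * (real b ^ length w * Jint l))"
      unfolding lessThan_atLeast0 using less by (intro sum.cong refl) (auto simp: Pcoeff_def)
    also have "\<dots> = real b ^ length w * (\<Sum>l<m. Acoeff m l * Jint l)"
      by (simp add: sum_distrib_left mult_ac)
    also have "(\<Sum>l<m. Acoeff m l * Jint l) = (1 - Acoeff m m) * Jint m"
      using Jint_invariant[of m] by (simp add: split algebra_simps)
    finally have "(1 - Acoeff m m) * acoeff m 0 = (1 - Acoeff m m) * (real b ^ length w * Jint m)"
      by (simp add: Pcoeff_def mult_ac)
    moreover have "1 - Acoeff m m \<noteq> 0"
      using b_zpt_le[of m] False by (simp add: Acoeff_def op_coeff_diag)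
    ultimately show ?thesis by simp
  qed
qed

section \<open>Taylor series of reciprocals about the fixed point\<close>

definition taylor :: "real \<Rightarrow> nat \<Rightarrow> real" where
  "taylor n m = (- 1) ^ m / (n + center) ^ Suc m"

text \<open>The threshold exceeds \<open>rad\<close>, so the decay of the Taylor coefficients, with
  ratio \<open>1 / (n + center)\<close>, beats the growth of \<open>acoeff\<close>.\<close>

definition far :: "real \<Rightarrow> bool" where
  "far n \<longleftrightarrow> n > 0 \<and> n + center \<ge> real b / (real b - 1)"

lemma rho_gt_1: "real b / (real b - 1) > 1"
  using b_ge2 by (simp add: field_simps)

lemma recip_remainder:
  assumes "n + center \<noteq> 0" "n + x \<noteq> 0"
  shows "recip n x - (\<Sum>m<N. taylor n m * cpow m x) = (- (x - center) / (n + center)) ^ N * recip n x"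
proof -
  let ?y = "- (x - center) / (n + center)"
  have "(- 1) ^ m / d ^ Suc m * a ^ m = 1 / d * (- a / d) ^ m" for a d :: real and m
    by (simp add: power_minus[of "a / d"] power_divide)
  then have "taylor n m * cpow m x = 1 / (n + center) * ?y ^ m" for m
    unfolding taylor_def cpow_def .
  then have "(1 - ?y) * (\<Sum>m<N. taylor n m * cpow m x) = 1 / (n + center) * ((1 - ?y) * (\<Sum>m<N. ?y ^ m))"
    by (simp add: sum_distrib_left mult_ac)
  also have "(1 - ?y) * (\<Sum>m<N. ?y ^ m) = 1 - ?y ^ N" by (rule one_diff_power_eq[symmetric])
  finally have 1: "(1 - ?y) * (\<Sum>m<N. taylor n m * cpow m x) = 1 / (n + center) * (1 - ?y ^ N)" .
  have 2: "1 - ?y = (n + x) / (n + center)" using assms by (simp add: field_simps)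
  have "(n + x) / (n + center) * (\<Sum>m<N. taylor n m * cpow m x) = 1 / (n + center) * (1 - ?y ^ N)"
    using 1 unfolding 2 .
  then have "(n + x) * (\<Sum>m<N. taylor n m * cpow m x) = 1 - ?y ^ N" using assms(1) by simp
  then have "(\<Sum>m<N. taylor n m * cpow m x) = (1 - ?y ^ N) / (n + x)" using assms(2) by (simp add: field_simps)
  then show ?thesis by (simp add: recip_def diff_divide_distrib)
qed

lemma block_sum_recip_sums:
  assumes "far n"
  shows "(\<lambda>m. taylor n m * mom k m) sums block_sum k (recip n)"
proof -
  define R where "R = real b / (real b - 1)"
  have n: "n > 0" "n + center \<ge> R" using assms by (auto simp: far_def R_def)
  have \<rho>: "R > 1" unfolding R_def by (rule rho_gt_1)
  let ?C = "block_sum k (\<lambda>_. 1)"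
  have bound: "\<bar>block_sum k (recip n) - (\<Sum>m<N. taylor n m * mom k m)\<bar> \<le> (1 / R) ^ N * (1 / n) * ?C" for N
  proof -
    \<comment> \<open>Slot \<open>N\<close> holds the reciprocal itself, so that the remainder is
      one finite combination to which \<open>wsum_sum\<close> applies.\<close>
    let ?f = "\<lambda>i. if i = N then recip n else cpow i" and ?c = "\<lambda>i. if i = N then 1 else - taylor n i"
    have sum: "(\<Sum>i\<le>N. ?c i * g (?f i)) = g (recip n) - (\<Sum>m<N. taylor n m * g (cpow m))" for g :: "(real \<Rightarrow> real) \<Rightarrow> real"
      unfolding lessThan_Suc_atMost[symmetric] by (simp add: sum_negf)
    have "wsum b (\<lambda>u. occ_ind w k (w @ u)) (\<lambda>x. \<Sum>i\<le>N. ?c i * ?f i x) = (\<Sum>i\<le>N. ?c i * block_sum k (?f i))"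
      unfolding block_sum_def by (intro wsum_sum finite_mass_block) (use n in \<open>auto intro: bdd01_recip bdd01_cpow\<close>)
    also have "\<dots> = block_sum k (recip n) - (\<Sum>m<N. taylor n m * mom k m)"
      unfolding mom_def by (rule sum)
    finally have eq: "wsum b (\<lambda>u. occ_ind w k (w @ u)) (\<lambda>x. recip n x - (\<Sum>m<N. taylor n m * cpow m x))
        = block_sum k (recip n) - (\<Sum>m<N. taylor n m * mom k m)"
      unfolding sum[of "\<lambda>h. h _"] .
    have "\<bar>wsum b (\<lambda>u. occ_ind w k (w @ u)) (\<lambda>x. recip n x - (\<Sum>m<N. taylor n m * cpow m x))\<bar>
        \<le> (1 / R) ^ N * (1 / n) * wsum b (\<lambda>u. occ_ind w k (w @ u)) (\<lambda>_. 1)"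
    proof (rule wsum_bound[OF finite_mass_block])
      fix x :: real assume x: "x \<in> {0..1}"
      have pos: "n + center > 0" "n + x > 0" using n \<rho> x by auto
      have "\<bar>- (x - center) / (n + center)\<bar> = \<bar>x - center\<bar> / (n + center)"
        using pos by (simp add: abs_divide)
      also have "\<dots> \<le> 1 / R" using x center_bounds n \<rho> by (intro frac_le) auto
      finally have y: "\<bar>- (x - center) / (n + center)\<bar> ^ N \<le> (1 / R) ^ N" by (intro power_mono) auto
      have "\<bar>recip n x\<bar> \<le> 1 / n" using n x by (auto simp: recip_def intro!: divide_left_mono)
      then have "\<bar>- (x - center) / (n + center)\<bar> ^ N * \<bar>recip n x\<bar> \<le> (1 / R) ^ N * (1 / n)"
        using y \<rho> by (intro mult_mono) auto
      then show "\<bar>recip n x - (\<Sum>m<N. taylor n m * cpow m x)\<bar> \<le> (1 / R) ^ N * (1 / n)"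
        using pos by (subst recip_remainder) (auto simp: abs_mult power_abs)
    qed
    then show ?thesis unfolding eq block_sum_def .
  qed
  have "(\<lambda>N. (1 / R) ^ N) \<longlonglongrightarrow> 0" using \<rho> by (intro LIMSEQ_power_zero) (simp add: divide_simps)
  then have "(\<lambda>N. (1 / R) ^ N * (1 / n) * ?C) \<longlonglongrightarrow> 0" by (intro tendsto_mult_left_zero)
  then have "(\<lambda>N. block_sum k (recip n) - (\<Sum>m<N. taylor n m * mom k m)) \<longlonglongrightarrow> 0"
    by (rule Lim_null_comparison[rotated]) (use bound in \<open>auto intro!: always_eventually\<close>)
  then have "(\<lambda>N. block_sum k (recip n) - (block_sum k (recip n) - (\<Sum>m<N. taylor n m * mom k m))) \<longlonglongrightarrow> block_sum k (recip n) - 0"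
    by (intro tendsto_diff tendsto_const)
  then show ?thesis by (simp add: sums_def)
qed

definition recip_coeff :: "real \<Rightarrow> nat \<Rightarrow> real" where
  "recip_coeff n j = (\<Sum>m. taylor n m * acoeff m j)"

lemma acoeff_greater: "j > m \<Longrightarrow> acoeff m j = 0"
  by (simp add: acoeff.simps)

text \<open>The moments in the Taylor series are replaced by their finite eigenvalue expansions. The
  rows are dominated by \<open>M * (rad / R) ^ m\<close>, so the sums may be interchanged, which
  collects the powers of each eigenvalue.\<close>

lemma recip_expansion:
  assumes "far n"
  shows "summable (\<lambda>j. \<bar>recip_coeff n j * eig j ^ k\<bar>)"
    and "block_sum (Suc k) (recip n) = (\<Sum>j. recip_coeff n j * eig j ^ k)"
proof -
  define R where "R = real b / (real b - 1)"
  have n: "n > 0" "n + center \<ge> R" using assms by (auto simp: far_def R_def)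
  have \<rho>: "R > 1" unfolding R_def by (rule rho_gt_1)
  obtain M where M: "M \<ge> 0" "\<And>m. (\<Sum>j\<le>m. \<bar>acoeff m j\<bar>) \<le> M * rad ^ m"
    using acoeff_growth by blast
  have t: "\<bar>taylor n m\<bar> \<le> 1 / R ^ m" for m
  proof -
    have "R ^ m \<le> R ^ Suc m" using \<rho> by (intro power_increasing) auto
    also have "\<dots> \<le> (n + center) ^ Suc m" using n \<rho> by (intro power_mono) auto
    finally have "1 / (n + center) ^ Suc m \<le> 1 / R ^ m"
      using \<rho> by (intro divide_left_mono mult_pos_pos zero_less_power) (use n \<rho> in auto)
    then show ?thesis using n \<rho> by (simp add: taylor_def abs_divide power_abs abs_mult)
  qed
  have geo: "summable (\<lambda>m. M * (rad / R) ^ m)"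
    using rad_less[folded R_def] rad_ge_1 \<rho> by (intro summable_mult summable_geometric) (simp add: divide_less_eq)
  have e1: "\<bar>eig j ^ k\<bar> \<le> 1" for j
    using eig_pos[of j] eig_antimono[of 0 j] eig_0 by (simp add: power_le_one)
  have S: "(\<Sum>j\<le>m. \<bar>taylor n m * acoeff m j * eig j ^ k\<bar>) \<le> M * (rad / R) ^ m" for m
  proof -
    have "(\<Sum>j\<le>m. \<bar>taylor n m * acoeff m j * eig j ^ k\<bar>) \<le> (\<Sum>j\<le>m. \<bar>taylor n m\<bar> * \<bar>acoeff m j\<bar>)"
      using e1 by (intro sum_mono) (simp only: abs_mult mult_left_le abs_ge_zero mult_nonneg_nonneg)
    also have "\<dots> = \<bar>taylor n m\<bar> * (\<Sum>j\<le>m. \<bar>acoeff m j\<bar>)" by (simp only: sum_distrib_left)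
    also have "\<dots> \<le> 1 / R ^ m * (M * rad ^ m)" using t[of m] M \<rho> by (intro mult_mono sum_nonneg) auto
    also have "\<dots> = M * (rad / R) ^ m" unfolding power_divide by simp
    finally show ?thesis .
  qed
  have sm: "summable (\<lambda>m. \<Sum>j\<le>m. \<bar>taylor n m * acoeff m j * eig j ^ k\<bar>)"
    using S by (intro summable_comparison_test'[OF geo, of 0]) (simp add: sum_nonneg)
  \<comment> \<open>Convergence without the factor \<open>eig j ^ k\<close> allows this factor to be
    pulled out of the series.\<close>
  have row: "summable (\<lambda>m. taylor n m * acoeff m j)" for j
  proof (rule summable_comparison_test'[OF geo, of 0])
    fix m
    have "\<bar>acoeff m j\<bar> \<le> M * rad ^ m"
    proof (cases "j \<le> m")
      case True
      then have "\<bar>acoeff m j\<bar> \<le> (\<Sum>j\<le>m. \<bar>acoeff m j\<bar>)" by (intro member_le_sum) auto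
      then show ?thesis using M(2)[of m] by linarith
    next
      case False
      then show ?thesis using M(1) rad_ge_1 by (simp add: acoeff_greater)
    qed
    then have "\<bar>taylor n m\<bar> * \<bar>acoeff m j\<bar> \<le> 1 / R ^ m * (M * rad ^ m)" using t[of m] \<rho> by (intro mult_mono) auto
    also have "\<dots> = M * (rad / R) ^ m" unfolding power_divide by simp
    finally show "norm (taylor n m * acoeff m j) \<le> M * (rad / R) ^ m" by (simp only: real_norm_def abs_mult)
  qed
  have col: "(\<Sum>m. taylor n m * acoeff m j * eig j ^ k) = recip_coeff n j * eig j ^ k" for j
    unfolding recip_coeff_def by (rule suminf_mult2[OF row, symmetric])
  have tri: "taylor n m * acoeff m j * eig j ^ k = 0" if "j > m" for m j
    using that by (simp add: acoeff_greater)
  from triangular_series_swap(1)[OF tri sm] show "summable (\<lambda>j. \<bar>recip_coeff n j * eig j ^ k\<bar>)"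
    unfolding col by simp
  have "(\<Sum>j. recip_coeff n j * eig j ^ k) = (\<Sum>m. \<Sum>j\<le>m. taylor n m * acoeff m j * eig j ^ k)"
    using triangular_series_swap(2)[OF tri sm] unfolding col by simp
  also have "\<dots> = (\<Sum>m. taylor n m * mom (Suc k) m)"
    by (simp add: mom_expansion sum_distrib_left mult.assoc)
  also have "\<dots> = block_sum (Suc k) (recip n)"
    using block_sum_recip_sums[OF assms, of "Suc k"] by (simp add: sums_iff)
  finally show "block_sum (Suc k) (recip n) = (\<Sum>j. recip_coeff n j * eig j ^ k)" by simp
qed

text \<open>Up to the factor \<open>b ^ length w\<close> this is the integral of
  \<open>1 / (n + x)\<close> over [0,1], taken termwise in the Taylor series: the endpoints give
  logarithmic series in \<open>(1 - center) / (n + center)\<close> and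
  \<open>- center / (n + center)\<close>.\<close>

lemma recip_coeff_0:
  assumes "far n"
  shows "recip_coeff n 0 = real b ^ length w * (ln (n + 1) - ln n)"
proof -
  have n: "n > 0" "n + center \<ge> real b / (real b - 1)" using assms by (auto simp: far_def)
  have nc: "n + center > 1" using n rho_gt_1 by linarith
  have ln_sums: "(\<lambda>m. (- 1) ^ m * y ^ Suc m / Suc m) sums ln (1 + y)" if "\<bar>y\<bar> < 1" for y :: real
  proof -
    have "(\<lambda>m. - ((- y) ^ m) / of_nat m) sums ln (1 + y)" using ln_series'[OF that] by simp
    then have "(\<lambda>m. - ((- y) ^ Suc m) / of_nat (Suc m)) sums ln (1 + y)" by (subst sums_Suc_iff) simp
    then show ?thesis by (simp add: power_minus' mult_ac)
  qed
  have y1: "\<bar>(1 - center) / (n + center)\<bar> < 1" "\<bar>- center / (n + center)\<bar> < 1"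
    using center_bounds nc by (auto simp: abs_divide divide_less_eq)
  have factor: "s * (x / d) / k - s * (y / d) / k = s / d * ((x - y) / k)" for s x y d k :: real
    by (simp add: diff_divide_distrib right_diff_distrib)
  have "(\<lambda>m. (- 1) ^ m * ((1 - center) / (n + center)) ^ Suc m / Suc m - (- 1) ^ m * (- center / (n + center)) ^ Suc m / Suc m)
    sums (ln (1 + (1 - center) / (n + center)) - ln (1 + (- center / (n + center))))"
    by (intro sums_diff ln_sums y1)
  moreover have "(- 1) ^ m * ((1 - center) / (n + center)) ^ Suc m / Suc m - (- 1) ^ m * (- center / (n + center)) ^ Suc m / Suc m
    = taylor n m * Jint m" for m
    unfolding taylor_def Jint_def power_divide by (rule factor)
  moreover have "1 + (1 - center) / (n + center) = (n + 1) / (n + center)" "1 + (- center / (n + center)) = n / (n + center)"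
    using nc by (auto simp: field_simps)
  ultimately have "(\<lambda>m. taylor n m * Jint m) sums (ln (n + 1) - ln n)"
    using n nc by (simp add: ln_div)
  from sums_mult[OF this, of "real b ^ length w"]
  show ?thesis unfolding recip_coeff_def acoeff_0 by (simp add: sums_iff mult_ac)
qed

section \<open>Calculus of eigenvalue expansions, keeping track of the coefficient of the eigenvalue
  1\<close>

definition expands :: "(nat \<Rightarrow> real) \<Rightarrow> real \<Rightarrow> bool" where
  "expands F c \<longleftrightarrow> (\<exists>\<alpha>. \<alpha> 0 = c \<and>
     (\<forall>k\<ge>1. summable (\<lambda>j. \<bar>\<alpha> j * eig j ^ k\<bar>) \<and> F k = (\<Sum>j. \<alpha> j * eig j ^ k)))"

lemma expandsE:
  assumes "expands F c"
  obtains \<alpha> where "\<alpha> 0 = c" "\<And>k. k \<ge> 1 \<Longrightarrow> summable (\<lambda>j. \<bar>\<alpha> j * eig j ^ k\<bar>)"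
    "\<And>k. k \<ge> 1 \<Longrightarrow> F k = (\<Sum>j. \<alpha> j * eig j ^ k)"
  using assms unfolding expands_def by blast

lemma expands_add:
  assumes "expands F c" "expands G d"
  shows "expands (\<lambda>k. F k + G k) (c + d)"
proof -
  obtain \<alpha> where \<alpha>: "\<alpha> 0 = c" "\<And>k. k \<ge> 1 \<Longrightarrow> summable (\<lambda>j. \<bar>\<alpha> j * eig j ^ k\<bar>)" "\<And>k. k \<ge> 1 \<Longrightarrow> F k = (\<Sum>j. \<alpha> j * eig j ^ k)"
    using assms(1) by (rule expandsE) blast
  obtain \<beta> where \<beta>: "\<beta> 0 = d" "\<And>k. k \<ge> 1 \<Longrightarrow> summable (\<lambda>j. \<bar>\<beta> j * eig j ^ k\<bar>)" "\<And>k. k \<ge> 1 \<Longrightarrow> G k = (\<Sum>j. \<beta> j * eig j ^ k)"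
    using assms(2) by (rule expandsE) blast
  have "summable (\<lambda>j. \<bar>(\<alpha> j + \<beta> j) * eig j ^ k\<bar>) \<and> F k + G k = (\<Sum>j. (\<alpha> j + \<beta> j) * eig j ^ k)" if k: "k \<ge> 1" for k
  proof
    show "summable (\<lambda>j. \<bar>(\<alpha> j + \<beta> j) * eig j ^ k\<bar>)"
      by (rule summable_comparison_test'[OF summable_add[OF \<alpha>(2)[OF k] \<beta>(2)[OF k]], of 0])
         (simp add: distrib_right abs_triangle_ineq)
    show "F k + G k = (\<Sum>j. (\<alpha> j + \<beta> j) * eig j ^ k)"
      using suminf_add[OF summable_rabs_cancel[OF \<alpha>(2)[OF k]] summable_rabs_cancel[OF \<beta>(2)[OF k]]]
      by (simp add: \<alpha>(3)[OF k] \<beta>(3)[OF k] distrib_right)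
  qed
  then show ?thesis unfolding expands_def using \<alpha>(1) \<beta>(1) by (intro exI[of _ "\<lambda>j. \<alpha> j + \<beta> j"]) auto
qed

lemma expands_cmult:
  assumes "expands F c"
  shows "expands (\<lambda>k. a * F k) (a * c)"
proof -
  obtain \<alpha> where \<alpha>: "\<alpha> 0 = c" "\<And>k. k \<ge> 1 \<Longrightarrow> summable (\<lambda>j. \<bar>\<alpha> j * eig j ^ k\<bar>)" "\<And>k. k \<ge> 1 \<Longrightarrow> F k = (\<Sum>j. \<alpha> j * eig j ^ k)"
    using assms by (rule expandsE) blast
  have "summable (\<lambda>j. \<bar>(a * \<alpha> j) * eig j ^ k\<bar>) \<and> a * F k = (\<Sum>j. (a * \<alpha> j) * eig j ^ k)" if k: "k \<ge> 1" for k
    using summable_mult[OF \<alpha>(2)[OF k], of "\<bar>a\<bar>"] suminf_mult[OF summable_rabs_cancel[OF \<alpha>(2)[OF k]], of a]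
    by (simp add: \<alpha>(3)[OF k] abs_mult mult.assoc)
  then show ?thesis unfolding expands_def using \<alpha>(1) by (intro exI[of _ "\<lambda>j. a * \<alpha> j"]) auto
qed

lemma expands_sum:
  assumes "finite I" "\<And>i. i \<in> I \<Longrightarrow> expands (F i) (c i)"
  shows "expands (\<lambda>k. \<Sum>i\<in>I. F i k) (\<Sum>i\<in>I. c i)"
  using assms
proof (induction I rule: finite_induct)
  case empty
  show ?case unfolding expands_def by (intro exI[of _ "\<lambda>_. 0"]) simp
next
  case (insert i I)
  then show ?case using expands_add[of "F i" "c i" "\<lambda>k. \<Sum>i\<in>I. F i k" "\<Sum>i\<in>I. c i"] by simp
qed

lemma expands_block_sum_Suc:
  assumes "far n"
  shows "expands (\<lambda>k. block_sum (Suc k) (recip n)) (real b ^ length w * (ln (n + 1) - ln n))"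
  unfolding expands_def using recip_coeff_0[OF assms] recip_expansion[OF assms]
  by (intro exI[of _ "recip_coeff n"]) simp

text \<open>A difference in \<open>k\<close> multiplies the coefficients by
  \<open>1 / eig j - 1\<close>, which is 0 for the eigenvalue 1; such terms do not affect the
  constant.\<close>

lemma expands_block_sum_diff:
  assumes "far n"
  shows "expands (\<lambda>k. block_sum k (recip n) - block_sum (Suc k) (recip n)) 0"
proof -
  let ?\<alpha> = "\<lambda>j. recip_coeff n j * (1 / eig j - 1)"
  have "summable (\<lambda>j. \<bar>?\<alpha> j * eig j ^ k\<bar>) \<and>
    block_sum k (recip n) - block_sum (Suc k) (recip n) = (\<Sum>j. ?\<alpha> j * eig j ^ k)" if "k \<ge> 1" for k
  proof -
    from that obtain l where k: "k = Suc l" by (cases k) auto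
    note E = recip_expansion[OF assms, of l] recip_expansion[OF assms, of k]
    have eq: "?\<alpha> j * eig j ^ k = recip_coeff n j * eig j ^ l - recip_coeff n j * eig j ^ k" for j
      using eig_pos[of j] unfolding k by (simp add: field_simps)
    have "summable (\<lambda>j. \<bar>?\<alpha> j * eig j ^ k\<bar>)" unfolding eq
      by (rule summable_comparison_test'[OF summable_add[OF E(1) E(3)], of 0]) (simp add: abs_triangle_ineq4)
    moreover have "(\<Sum>j. ?\<alpha> j * eig j ^ k) = block_sum k (recip n) - block_sum (Suc k) (recip n)"
      unfolding eq using suminf_diff[OF summable_rabs_cancel[OF E(1)] summable_rabs_cancel[OF E(3)]] E(2,4)
      by (simp add: k)
    ultimately show ?thesis by simp
  qed
  then show ?thesis unfolding expands_def by (intro exI[of _ ?\<alpha>]) (auto simp: eig_0)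
qed

lemma expands_cong: "expands F c \<Longrightarrow> (\<And>k. k \<ge> 1 \<Longrightarrow> F k = G k) \<Longrightarrow> expands G c"
  unfolding expands_def by auto

lemma far_ge_b:
  fixes n :: real
  shows "n \<ge> b \<Longrightarrow> far n"
proof -
  assume "n \<ge> b"
  moreover have "real b / (real b - 1) \<le> b"
    using b_ge2 by (simp add: divide_le_eq mult_left_mono[of 1 "real b - 1" b])
  ultimately show ?thesis using center_bounds(1) b_pos by (auto simp: far_def)
qed

text \<open>For a single digit \<open>d\<close> the center is \<open>d / (b - 1)\<close>, hence
  \<open>d + center = d * b / (b - 1)\<close>, which reaches the threshold, with equality for
  \<open>d = 1\<close>. The value of a longer \<open>w\<close> without leading zero is at least
  \<open>b\<close>.\<close>

lemma far_nval:
  assumes "hd w \<noteq> 0"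
  shows "far (nval b w)"
proof (cases "length w = 1")
  case True
  then obtain d where w: "w = [d]" by (metis length_Suc_conv length_0_conv One_nat_def)
  have "min_period = 1" using min_period_bounds True by simp
  moreover have "tail 1 = w" using tail_length True by simp
  moreover have nv: "nval b w = d" by (simp add: w)
  ultimately have c: "center = d / (real b - 1)" unfolding center_def by simp
  have "d \<ge> 1" using assms w by simp
  then have "real d + d / (real b - 1) \<ge> 1 + 1 / (real b - 1)"
    using b_ge2 by (intro add_mono divide_right_mono) auto
  moreover have "1 + 1 / (real b - 1) = real b / (real b - 1)" using b_ge2 by (simp add: field_simps)
  ultimately show ?thesis using \<open>d \<ge> 1\<close> unfolding far_def c nv by simp
next
  case False
  have "b ^ 1 \<le> b ^ (length w - 1)"
    using False w_ne b_ge2 by (intro power_increasing) (auto simp: Suc_le_eq less_diff_conv, cases w, auto)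
  then have "nval b w \<ge> b" using nval_ge_power[OF w_ne assms, of b] by simp
  then show ?thesis by (intro far_ge_b) simp
qed

text \<open>The period terms are differences in \<open>k\<close> and leave the constant untouched;
  the factor -1 reverses their order to that of \<open>expands_block_sum_diff\<close>.\<close>

lemma expands_free_sum:
  fixes n :: real
  assumes "n \<ge> b"
  shows "expands (\<lambda>k. free_sum k (recip n)) (real b ^ length w * (ln (n + 1) - ln n))"
proof -
  have n: "n > 0" using assms b_pos by linarith
  have "expands (\<lambda>k. block_sum (Suc k) (recip n) + (\<Sum>q\<in>periods w. - 1 *
      (block_sum k (recip (n * real b ^ length (tail q) + nval b (tail q)))
       - block_sum (Suc k) (recip (n * real b ^ length (tail q) + nval b (tail q))))))
    (real b ^ length w * (ln (n + 1) - ln n) + (\<Sum>q\<in>periods w. - 1 * 0))"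
  proof (intro expands_add expands_sum expands_cmult expands_block_sum_Suc expands_block_sum_diff far_ge_b assms finite_periods)
    fix q
    have "n * 1 \<le> n * real b ^ length (tail q)" using n b_pos by (intro mult_left_mono) (auto simp: one_le_power)
    then show "b \<le> n * real b ^ length (tail q) + nval b (tail q)" using assms by simp
  qed
  then show ?thesis
    by (simp add: free_sum_eq_block_sum[OF bdd01_recip[OF n]] block_op_recip sum_subtractf)
qed

text \<open>A further digit \<open>e\<close> is split off behind the first digit \<open>d\<close>,
  because \<open>d\<close> itself may lie below the threshold whereas
  \<open>d * b + e \<ge> b\<close>. The logarithmic constants telescope, first over \<open>e\<close>
  and then over \<open>d\<close>, to \<open>ln b\<close>.\<close>

lemma expands_I_sum: "expands (I_sum b w) (real b ^ length w * ln b)"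
proof -
  let ?D = "\<lambda>n k. block_sum k (recip n) - block_sum (Suc k) (recip n)"
  let ?L = "real b ^ length w"
  have "expands (\<lambda>k. (\<Sum>d\<in>{1..<b}. (\<Sum>e<b. free_sum k (recip (real d * b + e))) + ?D (real d * real b ^ length w + nval b w) k)
      + of_bool (hd w \<noteq> 0) * ?D (nval b w) k)
    ((\<Sum>d\<in>{1..<b}. (\<Sum>e<b. ?L * (ln (real d * b + e + 1) - ln (real d * b + e))) + 0) + of_bool (hd w \<noteq> 0) * 0)"
  proof (intro expands_add expands_sum expands_free_sum expands_block_sum_diff far_ge_b finite_lessThan finite_atLeastLessThan)
    fix d e assume "d \<in> {1..<b}"
    then have "1 * real b \<le> real d * b" by (intro mult_right_mono) auto
    then show "real b \<le> real d * b + real e" by simp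
  next
    fix d assume d: "d \<in> {1..<b}"
    have "real b ^ 1 \<le> real b ^ length w" using b_ge2 w_ne by (intro power_increasing) (auto simp: Suc_le_eq)
    then have "1 * real b \<le> real d * real b ^ length w" using d by (intro mult_mono) auto
    then show "real b \<le> real d * real b ^ length w + nval b w" by simp
  next
    show "expands (\<lambda>k. of_bool (hd w \<noteq> 0) * ?D (nval b w) k) (of_bool (hd w \<noteq> 0) * 0)"
    proof (cases "hd w = 0")
      case True
      then show ?thesis using expands_sum[of "{}"] by simp
    next
      case False
      then show ?thesis using expands_cmult[OF expands_block_sum_diff[OF far_nval[OF False]], of 1] by simp
    qed
  qed
  moreover have "(\<Sum>d\<in>{1..<b}. (\<Sum>e<b. ?L * (ln (real d * b + e + 1) - ln (real d * b + e))) + 0) + of_bool (hd w \<noteq> 0) * 0 = ?L * ln b"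
  proof -
    have "(\<Sum>e<b. ln (real d * b + e + 1) - ln (real d * b + e)) = ln (real (Suc d)) - ln (real d)" if "d \<ge> 1" for d
    proof -
      have "(\<Sum>e<b. ln (real d * b + e + 1) - ln (real d * b + e)) = ln (real d * b + b) - ln (real d * b)"
        using sum_lessThan_telescope[of "\<lambda>e. ln (real d * b + real e)" b] by (simp add: add_ac)
      also have "real d * b + b = real (Suc d) * b" by (simp add: algebra_simps)
      finally show ?thesis using that b_pos by (simp add: ln_mult)
    qed
    then have "(\<Sum>d\<in>{1..<b}. (\<Sum>e<b. ?L * (ln (real d * b + e + 1) - ln (real d * b + e)))) = (\<Sum>d\<in>{1..<b}. ?L * (ln (real (Suc d)) - ln (real d)))"
      unfolding sum_distrib_left[symmetric] by (intro sum.cong arg_cong2[of _ _ _ _ "(*)"] refl) auto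
    also have "\<dots> = ?L * (\<Sum>d\<in>{1..<b}. ln (real (Suc d)) - ln (real d))" by (simp only: sum_distrib_left)
    also have "(\<Sum>d\<in>{1..<b}. ln (real (Suc d)) - ln (real d)) = ln b - ln (real 1)"
      using b_ge2 by (intro sum_Suc_diff') simp
    finally show ?thesis by simp
  qed
  moreover have "(\<Sum>d\<in>{1..<b}. (\<Sum>e<b. free_sum k (recip (real d * b + e))) + ?D (real d * real b ^ length w + nval b w) k)
      + of_bool (hd w \<noteq> 0) * ?D (nval b w) k = I_sum b w k" if "k \<ge> 1" for k
  proof -
    \<comment> \<open>For \<open>k \<ge> 1\<close> the empty-word term of
      \<open>free_sum_first_letter\<close> vanishes.\<close>
    have "free_sum k (recip (real d)) = (\<Sum>e<b. free_sum k (recip (real d * b + e))) + ?D (real d * real b ^ length w + nval b w) k"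
      if "d \<in> {1..<b}" for d
      using free_sum_first_letter[OF bdd01_recip[of "real d"], of k] that \<open>k \<ge> 1\<close> by (simp add: block_op_recip)
    then show ?thesis unfolding I_sum_eq by simp
  qed
  ultimately show ?thesis using expands_cong by simp
qed

lemma eig_formula:
  fixes m :: nat and z q :: real and p :: nat
  defines "z \<equiv> 1 / real b ^ Suc m" and "p \<equiv> length w"
  defines "q \<equiv> \<Sum>l\<in>border_lengths w. z ^ (p - l)"
  shows "eig m = (z ^ p + (1 - b * z) * q) / (z ^ p + (1 - b * z) * (1 + q))"
proof -
  have "q = Qsum m" unfolding q_def p_def Qsum_def z_def zpt_def by (rule sum_border_lengths)
  then show ?thesis unfolding eig_def Pcoeff_diag Bcoeff_diag p_def z_def zpt_def[symmetric]
    by (simp add: algebra_simps)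
qed

end

section \<open>Closed form of the eigenvalues and conclusion\<close>

definition eigenvalue :: "nat \<Rightarrow> nat list \<Rightarrow> nat \<Rightarrow> real" where
  "eigenvalue b w j = (let z = 1 / real b ^ j; q = (\<Sum>l\<in>border_lengths w. z ^ (length w - l))
     in (z ^ length w + (1 - b * z) * q) / (z ^ length w + (1 - b * z) * (1 + q)))"

text \<open>Matches the numbering from 1 in the theorem with the degrees, which start at 0.\<close>

lemma (in block) eigenvalue_eq_eig: "eigenvalue b w (Suc m) = eig m"
  unfolding eigenvalue_def Let_def eig_formula ..

lemma eigenvalue_Rats: "eigenvalue b w j \<in> \<rat>"
  unfolding eigenvalue_def Let_def by (intro Rats_divide Rats_add Rats_mult Rats_diff Rats_power Rats_sum Rats_1 Rats_of_nat)

text \<open>Without borders the period sum vanishes; multiplying numerator and denominator by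
  \<open>b ^ (length w * j)\<close> gives the formula.\<close>

lemma eigenvalue_unbordered:
  assumes "b > 1" "w \<noteq> []" "\<nexists>v. is_border v w"
  shows "eigenvalue b w j = inverse (real b ^ (length w * j) - real b ^ (length w * j - j + 1) + 1)"
proof -
  let ?p = "length w"
  have E: "border_lengths w = {}" using assms by (auto simp: border_lengths_def)
  \<comment> \<open>Ensures that the natural number subtraction \<open>?p * j - j\<close> is
    exact.\<close>
  have "j \<le> ?p * j" using assms by (cases w) auto
  then have e: "real b ^ (?p * j - j + 1) * real b ^ j = real b ^ (?p * j) * b"
    by (simp flip: power_add power_Suc2)
  define X Y where "X = real b ^ (?p * j)" and "Y = real b ^ j"
  have XY: "X > 0" "Y > 0" using assms by (auto simp: X_def Y_def)
  have z: "(1 / Y) ^ ?p = 1 / X" by (simp add: X_def Y_def power_one_over mult.commute flip: power_mult)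
  have "real b ^ (?p * j - j + 1) = X * b / Y" using e XY by (simp add: X_def Y_def field_simps)
  moreover have "eigenvalue b w j = (1 / X) / (1 / X + (1 - b * (1 / Y)))"
    unfolding eigenvalue_def E Let_def Y_def[symmetric] z by simp
  moreover have "(1 / X) / (1 / X + (1 - b * (1 / Y))) = inverse (X - X * b / Y + 1)"
  proof -
    have "(1 / X) / (1 / X + (1 - b * (1 / Y))) = (1 / X * X) / ((1 / X + (1 - b * (1 / Y))) * X)"
      using XY by simp
    also have "\<dots> = 1 / (X - X * b / Y + 1)" using XY by (simp add: algebra_simps)
    finally show ?thesis by (simp add: inverse_eq_divide)
  qed
  ultimately show ?thesis by (simp add: X_def)
qed

lemma no_border_length_1: "length w = 1 \<Longrightarrow> \<nexists>v. is_border v w"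
  by (auto simp: is_border_def prefix_def length_Suc_conv Cons_eq_append_conv append_eq_Cons_conv)

lemma eigenvalue_expansion:
  assumes "block b w"
  shows "\<exists>a :: nat \<Rightarrow> real. \<forall>k\<ge>1. summable (\<lambda>j. \<bar>a (j + 2) * eigenvalue b w (j + 2) ^ k\<bar>) \<and>
    I_sum b w k = real b ^ length w * ln (real b) + (\<Sum>j. a (j + 2) * eigenvalue b w (j + 2) ^ k)"
proof -
  interpret block b w by (rule assms)
  obtain \<alpha> where \<alpha>: "\<alpha> 0 = real b ^ length w * ln (real b)"
    "\<And>k. k \<ge> 1 \<Longrightarrow> summable (\<lambda>j. \<bar>\<alpha> j * eig j ^ k\<bar>)"
    "\<And>k. k \<ge> 1 \<Longrightarrow> I_sum b w k = (\<Sum>j. \<alpha> j * eig j ^ k)"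
    using expands_I_sum by (rule expandsE) blast
  have "summable (\<lambda>j. \<bar>\<alpha> (Suc j) * eig (Suc j) ^ k\<bar>) \<and>
    I_sum b w k = real b ^ length w * ln (real b) + (\<Sum>j. \<alpha> (Suc j) * eig (Suc j) ^ k)" if k: "k \<ge> 1" for k
  proof
    show "summable (\<lambda>j. \<bar>\<alpha> (Suc j) * eig (Suc j) ^ k\<bar>)"
      using \<alpha>(2)[OF k] by (subst summable_Suc_iff)
    show "I_sum b w k = real b ^ length w * ln (real b) + (\<Sum>j. \<alpha> (Suc j) * eig (Suc j) ^ k)"
      using suminf_split_head[OF summable_rabs_cancel[OF \<alpha>(2)[OF k]]] by (simp add: \<alpha>(1) \<alpha>(3)[OF k] eig_0)
  qed
  \<comment> \<open>The witness shifts the index by one; \<open>\<alpha> 0\<close>, belonging to the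
    first eigenvalue, has been split off as the constant.\<close>
  then show ?thesis by (intro exI[of _ "\<lambda>i. \<alpha> (i - 1)"]) (simp add: eigenvalue_eq_eig)
qed

theorem theorem1:
  "\<exists>(lam :: nat \<Rightarrow> nat list \<Rightarrow> nat \<Rightarrow> real) (alpha :: nat \<Rightarrow> nat list \<Rightarrow> nat \<Rightarrow> real).
    (\<forall>b w. b > 1 \<and> nonempty_word b w \<longrightarrow>
       lam b w 1 = 1 \<and>
       (\<forall>j\<ge>1. lam b w (j + 1) < lam b w j) \<and>
       (\<forall>j\<ge>1. lam b w j > 0) \<and>
       lam b w \<longlonglongrightarrow> 0 \<and>
       (\<forall>k\<ge>1.
          summable (\<lambda>j. \<bar>alpha b w (j + 2) * lam b w (j + 2) ^ k\<bar>) \<and>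
          I_sum b w k = real b ^ length w * ln (real b)
                        + (\<Sum>j. alpha b w (j + 2) * lam b w (j + 2) ^ k)) \<and>
       (\<forall>j\<ge>1. lam b w j \<in> \<rat>) \<and>
       ((\<nexists>v. is_border v w) \<longrightarrow>
          (\<forall>j\<ge>1. lam b w j =
             inverse (real b ^ (length w * j) - real b ^ (length w * j - j + 1) + 1))) \<and>
       (length w = 1 \<longrightarrow> (\<nexists>v. is_border v w))) \<and>
    (\<forall>b w w'. b > 1 \<and> nonempty_word b w \<and> nonempty_word b w' \<and>
       length w = length w' \<and> border_lengths w = border_lengths w' \<longrightarrow>
       (\<forall>j\<ge>1. lam b w j = lam b w' j))"
proof -
  let ?Q = "\<lambda>b w a. \<forall>k\<ge>1. summable (\<lambda>j. \<bar>a (j + 2) * eigenvalue b w (j + 2) ^ k\<bar>) \<and>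
    I_sum b w k = real b ^ length w * ln (real b) + (\<Sum>j. a (j + 2) * eigenvalue b w (j + 2) ^ k)"
  define alpha where "alpha b w = (SOME a. ?Q b w a)" for b w
  have main: "eigenvalue b w 1 = 1 \<and>
       (\<forall>j\<ge>1. eigenvalue b w (j + 1) < eigenvalue b w j) \<and>
       (\<forall>j\<ge>1. eigenvalue b w j > 0) \<and>
       eigenvalue b w \<longlonglongrightarrow> 0 \<and>
       ?Q b w (alpha b w) \<and>
       (\<forall>j\<ge>1. eigenvalue b w j \<in> \<rat>) \<and>
       ((\<nexists>v. is_border v w) \<longrightarrow>
          (\<forall>j\<ge>1. eigenvalue b w j =
             inverse (real b ^ (length w * j) - real b ^ (length w * j - j + 1) + 1))) \<and>
       (length w = 1 \<longrightarrow> (\<nexists>v. is_border v w))"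
    if bw: "b > 1 \<and> nonempty_word b w" for b w
  proof -
    have "block b w" using bw by unfold_locales (auto simp: nonempty_word_def)
    then interpret block b w .
    have ev: "eigenvalue b w j = eig (j - 1)" if "j \<ge> 1" for j
      using eigenvalue_eq_eig[of "j - 1"] that by simp
    have "eigenvalue b w \<longlonglongrightarrow> 0"
      by (rule LIMSEQ_imp_Suc) (simp add: eigenvalue_eq_eig eig_tendsto_0)
    moreover have "?Q b w (alpha b w)"
      unfolding alpha_def by (rule someI_ex[OF eigenvalue_expansion]) fact
    moreover have "eigenvalue b w (j + 1) < eigenvalue b w j" if "j \<ge> 1" for j
      using that by (simp add: ev eig_strict)
    moreover have "eigenvalue b w j > 0" if "j \<ge> 1" for j
      using that by (simp add: ev eig_pos)
    moreover have "eigenvalue b w 1 = 1" by (simp add: ev eig_0)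
    moreover have "(\<nexists>v. is_border v w) \<longrightarrow> (\<forall>j\<ge>1. eigenvalue b w j =
        inverse (real b ^ (length w * j) - real b ^ (length w * j - j + 1) + 1))"
      using eigenvalue_unbordered bw w_ne by blast
    ultimately show ?thesis
      using no_border_length_1 eigenvalue_Rats by blast
  qed
  have same: "eigenvalue b w j = eigenvalue b w' j"
    if "length w = length w'" "border_lengths w = border_lengths w'" for b w w' j
    using that by (simp add: eigenvalue_def)
  show ?thesis
    by (rule exI[of _ eigenvalue], rule exI[of _ alpha], rule conjI)
       (intro allI impI, rule main, assumption, intro allI impI, elim conjE, rule same, assumption, assumption)
qed

end
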